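(* Let $N\ge 2$ and let $H=(h_{k,j})\in\mathbb{R}^{(N-1)\times(N-1)}$ be a lower triangular matrix. Consider the proximal-point algorithm which, given a maximally monotone operator $A$ and a starting point $y_0$, sets $x_{k+1}=J_Ay_k$ and $g_{k+1}=y_k-x_{k+1}\in Ax_{k+1}$ for $k=0,\dots,N-1$, where $$y_{k+1}=y_k-\sum_{j=0}^{k}2h_{k+1,j+1}\,g_{j+1},\qquad k=0,\dots,N-2.$$ The algorithm achieves the exact optimal worst-case rate $$\|g_N\|^2\le\frac{\|y_0-y_\star\|^2}{N^2},\qquad g_N=y_{N-1}-x_N\in Ax_N,$$ over the class of maximally monotone operators (i.e. this inequality holds for every $d\ge1$, every maximally monotone $A:\mathbb{R}^d\rightrightarrows\mathbb{R}^d$ having a zero, every $y_\star$ with $0\in Ay_\star$, and every $y_0\in\mathbb{R}^d$) if and only if $$\begin{cases}P(N-1,m;H)=\dfrac1N\dbinom{N}{m+1}, & m=1,\dots,N-1,\\[2mm] \lambda^\star_{k,j}(H)\ge 0, & k=2,\dots,N,\ j=1,\dots,k-1.\end{cases}$$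
   Context: $A:\mathbb{R}^d\rightrightarrows\mathbb{R}^d$ is monotone if $\langle u-v,x-y\rangle\ge0$ for all $u\in Ax$, $v\in Ay$, and maximally monotone if its graph is maximal with this property. $J_A=(I+A)^{-1}$ is the resolvent (single-valued with full domain for maximally monotone $A$). For a lower triangular $H=(h_{i,j})\in\mathbb{R}^{(N-1)\times(N-1)}$ define the H-invariants, for $m=1,\dots,N-1$, $$P(N-1,m;H)=\sum_{1\le j(1)\le i(1)<j(2)\le i(2)<\cdots<j(m)\le i(m)\le N-1}\ \prod_{r=1}^m h_{i(r),j(r)}.$$ Define, for $m,j\in\{1,\dots,N-1\}$, the Q-functions $$Q(N-1,m,j;H)=\sum_{j=j(1)\le i(1)<j(2)\le i(2)<\cdots<j(m)\le i(m)\le N-1}\ \prod_{r=1}^m h_{i(r),j(r)}$$ (empty sums are $0$). The H-certificates $\lambda^\star_{k,j}(H)$, $1\le j<k\le N$, are $$\lambda^\star_{N,j}(H)=N\sum_{m=1}^{N-j}(-1)^{m-1}Q(N-1,m,j;H),\qquad j=1,\dots,N-1,$$ and for $1\le j<k\le N-1$ $$\lambda^\star_{k,j}(H)=N\sum_{\ell=1}^{N-j}\sum_{m=1}^{N-k}(-1)^{\ell+m-1}\binom{\ell+m}{m}Q(N-1,\ell,j;H)\,Q(N-1,m,k;H).$$ *)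

theory Defs
  imports Complex_Main "HOL-Library.FuncSet" "Jordan_Normal_Form.Matrix"
begin

section \<open>Monotone operators on finite-dimensional Euclidean spaces\<close>

text \<open>The dimension \<open>d\<close> is quantified inside the statement, so Euclidean \<open>d\<close>-space is
  \<^term>\<open>carrier_vec d :: real vec set\<close>. A set-valued operator is identified with its graph;
  the image of a point \<open>x\<close> under \<open>A\<close> is \<open>A `` {x}\<close>.\<close>

definition sq_norm_v :: "real vec \<Rightarrow> real" where
  "sq_norm_v v = v \<bullet> v"

definition monotone_operator :: "nat \<Rightarrow> (real vec \<times> real vec) set \<Rightarrow> bool" where
  "monotone_operator d A \<longleftrightarrow>
     A \<subseteq> carrier_vec d \<times> carrier_vec d \<and>
     (\<forall>(x, u) \<in> A. \<forall>(y, v) \<in> A. 0 \<le> (u - v) \<bullet> (x - y))"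

definition maximally_monotone :: "nat \<Rightarrow> (real vec \<times> real vec) set \<Rightarrow> bool" where
  "maximally_monotone d A \<longleftrightarrow>
     monotone_operator d A \<and> (\<forall>B. monotone_operator d B \<and> A \<subseteq> B \<longrightarrow> B = A)"

definition resolvent :: "(real vec \<times> real vec) set \<Rightarrow> (real vec \<times> real vec) set" where
  "resolvent A = {(x, x + u) | x u. (x, u) \<in> A}\<inverse>"

section \<open>Proximal-point algorithms with a fixed step matrix\<close>

definition lower_triangular :: "real mat \<Rightarrow> bool" where
  "lower_triangular H \<longleftrightarrow> (\<forall>i < dim_row H. \<forall>j < dim_col H. i < j \<longrightarrow> H $$ (i, j) = 0)"

text \<open>Entries of \<open>H\<close> in one-based indexing (the library's matrices are zero-based).\<close>

definition entry :: "real mat \<Rightarrow> nat \<Rightarrow> nat \<Rightarrow> real" where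
  "entry H i j = H $$ (i - 1, j - 1)"

text \<open>The resolvent is a set-valued operator; \<open>x (k + 1)\<close> being its value at \<open>y k\<close> is expressed
  by its image of \<open>y k\<close> being the singleton of \<open>x (k + 1)\<close>. Only \<open>x 1, \<dots>, x N\<close>,
  \<open>g 1, \<dots>, g N\<close> and \<open>y 0, \<dots>, y (N - 1)\<close> are constrained.\<close>

definition ppm_iterates ::
  "nat \<Rightarrow> real mat \<Rightarrow> nat \<Rightarrow> (real vec \<times> real vec) set \<Rightarrow>
   (nat \<Rightarrow> real vec) \<Rightarrow> (nat \<Rightarrow> real vec) \<Rightarrow> (nat \<Rightarrow> real vec) \<Rightarrow> bool" where
  "ppm_iterates N H d A x g y \<longleftrightarrow>
     y 0 \<in> carrier_vec d \<and>
     (\<forall>k < N. resolvent A `` {y k} = {x (k + 1)} \<and> g (k + 1) = y k - x (k + 1)) \<and>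
     (\<forall>k < N - 1. y (k + 1) =
        y k - finsum_vec TYPE(real) d (\<lambda>j. (2 * entry H (k + 1) (j + 1)) \<cdot>\<^sub>v g (j + 1)) {0..k})"

definition achieves_optimal_rate :: "nat \<Rightarrow> real mat \<Rightarrow> bool" where
  "achieves_optimal_rate N H \<longleftrightarrow>
     (\<forall>d \<ge> 1. \<forall>A y_star x g y.
        maximally_monotone d A \<and> (y_star, 0\<^sub>v d) \<in> A \<and> ppm_iterates N H d A x g y \<longrightarrow>
        sq_norm_v (g N) \<le> sq_norm_v (y 0 - y_star) / (real N)\<^sup>2)"

section \<open>H-invariants, Q-functions and H-certificates\<close>

text \<open>Index families with \<open>j 1 \<le> i 1 < j 2 \<le> i 2 < \<dots> < j m \<le> i m\<close> in \<open>{1..n}\<close>;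
  extensionality outside \<open>{1..m}\<close> makes each family count once.\<close>

definition index_chains :: "nat \<Rightarrow> nat \<Rightarrow> ((nat \<Rightarrow> nat) \<times> (nat \<Rightarrow> nat)) set" where
  "index_chains n m =
     {(i, j). i \<in> {1..m} \<rightarrow>\<^sub>E {1..n} \<and> j \<in> {1..m} \<rightarrow>\<^sub>E {1..n} \<and>
        (\<forall>r \<in> {1..m}. j r \<le> i r) \<and> (\<forall>r \<in> {1..<m}. i r < j (r + 1))}"

definition H_invariant :: "nat \<Rightarrow> nat \<Rightarrow> real mat \<Rightarrow> real" where
  "H_invariant n m H = (\<Sum>(i, j) \<in> index_chains n m. \<Prod>r = 1..m. entry H (i r) (j r))"

definition Q_function :: "nat \<Rightarrow> nat \<Rightarrow> nat \<Rightarrow> real mat \<Rightarrow> real" where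
  "Q_function n m j\<^sub>1 H =
     (\<Sum>(i, j) \<in> {(i, j) \<in> index_chains n m. j 1 = j\<^sub>1}. \<Prod>r = 1..m. entry H (i r) (j r))"

definition H_certificate :: "nat \<Rightarrow> nat \<Rightarrow> nat \<Rightarrow> real mat \<Rightarrow> real" where
  "H_certificate N k j H =
     (if k = N
      then real N * (\<Sum>m = 1..N - j. (-1) ^ (m - 1) * Q_function (N - 1) m j H)
      else real N * (\<Sum>l = 1..N - j. \<Sum>m = 1..N - k.
             (-1) ^ (l + m - 1) * real ((l + m) choose m) *
             Q_function (N - 1) l j H * Q_function (N - 1) m k H))"

end

theory Submission
  imports Defs "HOL-Computational_Algebra.Polynomial" "HOL-Computational_Algebra.Formal_Power_Series"
begin

text \<open>Collect the Q-functions in polynomials \<open>q k = (\<Sum>m\<ge>1. Q m k t^m)\<close> for \<open>k < N\<close> and \<open>q N = 1\<close>.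
  The certificates are \<open>- N * B (q k) (q j)\<close> for the symmetric form \<open>B\<close> with
  \<open>B (t^l) (t^m) = (-1)^(l + m) * (l + m choose m)\<close>. Prescribing the invariants means prescribing the
  sum \<open>\<pi>\<close> of the \<open>q k\<close>, and the prescribed value satisfies \<open>B \<pi> p = p(0) / N\<close>. Together with
  Pascal's rule for \<open>B\<close> this turns the certificate-weighted sum of the monotonicity products into
  \<open>\<langle>g N, y 0 - x N - N g N\<rangle>\<close>, which yields the rate.

  Conversely, on the skew operator whose reflected resolvent is the negacyclic shift of \<open>N\<close>
  coordinates, the rate together with Cauchy--Schwarz forces \<open>2 g N = (1/N, \<dots>, 1/N)\<close>, which
  determines the invariants. All monotonicity products vanish on this instance and their first
  variations can be prescribed freely, so a negative certificate could be exploited to break the rate.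
  Finite monotone data extend to a maximally monotone operator by Zorn's lemma.\<close>

section \<open>Recursion for the Q-functions\<close>

definition chain_weight :: "real mat \<Rightarrow> nat \<Rightarrow> (nat \<Rightarrow> nat) \<times> (nat \<Rightarrow> nat) \<Rightarrow> real" where
  "chain_weight H m = (\<lambda>(i, j). \<Prod>r = 1..m. entry H (i r) (j r))"

lemma finite_index_chains: "finite (index_chains n m)"
proof (rule finite_subset)
  show "index_chains n m \<subseteq> ({1..m} \<rightarrow>\<^sub>E {1..n}) \<times> ({1..m} \<rightarrow>\<^sub>E {1..n})"
    by (auto simp: index_chains_def)
qed (auto intro!: finite_PiE)

lemma Q_function_alt:
  "Q_function n m k H = (\<Sum>c \<in> {c \<in> index_chains n m. snd c 1 = k}. chain_weight H m c)"
  unfolding Q_function_def chain_weight_def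
  by (intro sum.cong) (auto simp: case_prod_beta)

lemma H_invariant_eq_sum_Q_function:
  assumes "1 \<le> m"
  shows "H_invariant n m H = (\<Sum>k = 1..n. Q_function n m k H)"
proof -
  have *: "snd c 1 \<in> {1..n}" if "c \<in> index_chains n m" for c
    using that assms by (auto simp: index_chains_def PiE_iff)
  have "H_invariant n m H = (\<Sum>c \<in> index_chains n m. chain_weight H m c)"
    by (simp add: H_invariant_def chain_weight_def)
  also have "\<dots> = (\<Sum>k = 1..n. \<Sum>c \<in> {c \<in> index_chains n m. snd c 1 = k}. chain_weight H m c)"
    by (rule sum.group [symmetric]) (use * in \<open>auto simp: finite_index_chains\<close>)
  finally show ?thesis
    by (simp add: Q_function_alt)
qed

text \<open>Restricting to the index range keeps the families extensional, so that prepending a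
  first index and dropping it are exact inverses.\<close>

definition cons_index :: "nat \<Rightarrow> nat \<Rightarrow> (nat \<Rightarrow> nat) \<Rightarrow> nat \<Rightarrow> nat" where
  "cons_index m a f = (\<lambda>r\<in>{1..Suc m}. if r = 1 then a else f (r - 1))"

definition tail_index :: "nat \<Rightarrow> (nat \<Rightarrow> nat) \<Rightarrow> nat \<Rightarrow> nat" where
  "tail_index m f = (\<lambda>r\<in>{1..m}. f (Suc r))"

lemma cons_tail_index: "f \<in> extensional {1..Suc m} \<Longrightarrow> cons_index m (f 1) (tail_index m f) = f"
  by (auto simp: cons_index_def tail_index_def fun_eq_iff extensional_def restrict_def)

lemma tail_cons_index: "f \<in> extensional {1..m} \<Longrightarrow> tail_index m (cons_index m a f) = f"
  by (auto simp: cons_index_def tail_index_def fun_eq_iff extensional_def restrict_def)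

lemma cons_in_index_chains:
  assumes "(i, j) \<in> index_chains n m" "1 \<le> k" "k \<le> a" "a \<le> n" "1 \<le> m \<Longrightarrow> a < j 1"
  shows "(cons_index m a i, cons_index m k j) \<in> index_chains n (Suc m)"
proof -
  have r: "cons_index m a i r < cons_index m k j (r + 1)" if "r \<in> {1..<Suc m}" for r
  proof (cases "r = 1")
    case True
    then show ?thesis using assms that by (auto simp: cons_index_def)
  next
    case False
    then have "r - 1 \<in> {1..<m}" using that by auto
    then have "i (r - 1) < j (r - 1 + 1)" using assms(1) by (auto simp: index_chains_def)
    then show ?thesis using False that by (auto simp: cons_index_def)
  qed
  have i: "i s \<in> {1..n}" "j s \<in> {1..n}" "j s \<le> i s" if "s \<in> {1..m}" for s
    using assms(1) that by (auto simp: index_chains_def PiE_iff)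
  have s: "s - Suc 0 \<in> {1..m}" if "s \<in> {1..Suc m}" "s \<noteq> 1" for s
    using that by auto
  have 1: "cons_index m a i \<in> {1..Suc m} \<rightarrow>\<^sub>E {1..n}" "cons_index m k j \<in> {1..Suc m} \<rightarrow>\<^sub>E {1..n}"
    unfolding cons_index_def using i s assms by (auto simp: PiE_iff)
  have 2: "cons_index m k j r \<le> cons_index m a i r" if "r \<in> {1..Suc m}" for r
    using i(3)[OF s[OF that]] that assms by (auto simp: cons_index_def)
  show ?thesis
    using 1 2 r by (auto simp: index_chains_def)
qed

lemma tail_in_index_chains:
  assumes "(i, j) \<in> index_chains n (Suc m)"
  shows "(tail_index m i, tail_index m j) \<in> index_chains n m"
  using assms by (auto simp: index_chains_def tail_index_def PiE_iff)

lemma chain_weight_cons: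
  "chain_weight H (Suc m) (cons_index m a i, cons_index m k j) = entry H a k * chain_weight H m (i, j)"
proof -
  have "chain_weight H (Suc m) (cons_index m a i, cons_index m k j) =
    entry H a k * (\<Prod>r = Suc 1..Suc m. entry H (cons_index m a i r) (cons_index m k j r))"
    unfolding chain_weight_def prod.case
    by (subst prod.atLeast_Suc_atMost) (auto simp: cons_index_def)
  also have "(\<Prod>r = Suc 1..Suc m. entry H (cons_index m a i r) (cons_index m k j r)) =
    (\<Prod>r = 1..m. entry H (i r) (j r))"
    unfolding prod.shift_bounds_cl_Suc_ivl by (rule prod.cong) (auto simp: cons_index_def)
  finally show ?thesis by (simp add: chain_weight_def)
qed

text \<open>Splits off the first pair \<open>(i 1, j 1) = (a, k)\<close> of a chain; what remains is
  any chain starting beyond \<open>a\<close>. The guard \<open>1 \<le> m\<close> covers the empty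
  remainder, where \<open>snd c 1\<close> carries no information.\<close>

lemma Q_function_Suc_aux:
  assumes "1 \<le> k"
  shows "Q_function n (Suc m) k H =
    (\<Sum>a = k..n. entry H a k *
       (\<Sum>c \<in> {c \<in> index_chains n m. 1 \<le> m \<longrightarrow> a < snd c 1}. chain_weight H m c))"
proof -
  let ?S = "\<lambda>a. {c \<in> index_chains n m. 1 \<le> m \<longrightarrow> a < snd c 1}"
  let ?C = "{c \<in> index_chains n (Suc m). snd c 1 = k}"
  have ext: "fst c \<in> extensional {1..m} \<and> snd c \<in> extensional {1..m}" if "c \<in> index_chains n m" for c m
    using that by (auto simp: index_chains_def PiE_iff)
  have "(\<Sum>a = k..n. entry H a k * (\<Sum>c \<in> ?S a. chain_weight H m c)) =
      (\<Sum>(a, c) \<in> Sigma {k..n} ?S. entry H a k * chain_weight H m c)"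
    by (subst sum.Sigma [symmetric]) (auto simp: finite_index_chains sum_distrib_left)
  also have "\<dots> = (\<Sum>c \<in> ?C. chain_weight H (Suc m) c)"
  proof (rule sum.reindex_bij_witness
      [where j = "\<lambda>(a, i, j). (cons_index m a i, cons_index m k j)"
        and i = "\<lambda>(i, j). (i 1, tail_index m i, tail_index m j)"])
    fix p assume p: "p \<in> Sigma {k..n} ?S"
    obtain a i j where [simp]: "p = (a, i, j)" by (metis prod_cases3)
    have "cons_index m a i 1 = a" "cons_index m k j 1 = k"
      by (auto simp: cons_index_def)
    moreover have "tail_index m (cons_index m a i) = i" "tail_index m (cons_index m k j) = j"
      using p ext[of "(i,j)" m] by (auto simp: tail_cons_index)
    ultimately show "(case case p of (a, i, j) \<Rightarrow> (cons_index m a i, cons_index m k j) of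
        (i, j) \<Rightarrow> (i 1, tail_index m i, tail_index m j)) = p"
      and "(case p of (a, i, j) \<Rightarrow> (cons_index m a i, cons_index m k j)) \<in> ?C"
      using p assms by (auto intro!: cons_in_index_chains)
    show "chain_weight H (Suc m) (case p of (a, i, j) \<Rightarrow> (cons_index m a i, cons_index m k j)) =
        (case p of (a, c) \<Rightarrow> entry H a k * chain_weight H m c)"
      by (simp add: chain_weight_cons)
  next
    fix c assume c: "c \<in> ?C"
    obtain i j where [simp]: "c = (i, j)" by (metis prod.exhaust)
    from c have j1: "j 1 = k" and ij: "(i, j) \<in> index_chains n (Suc m)" by auto
    show "(case case c of (i, j) \<Rightarrow> (i 1, tail_index m i, tail_index m j) of
        (a, i, j) \<Rightarrow> (cons_index m a i, cons_index m k j)) = c"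
      using cons_tail_index[of i m] cons_tail_index[of j m] ext[OF ij] j1 by simp
    have "i 1 \<in> {k..n}" using ij j1 by (auto simp: index_chains_def PiE_iff)
    moreover have "1 \<le> m \<Longrightarrow> i 1 < tail_index m j 1"
      using ij by (force simp: index_chains_def tail_index_def)
    ultimately show "(case c of (i, j) \<Rightarrow> (i 1, tail_index m i, tail_index m j)) \<in> Sigma {k..n} ?S"
      using tail_in_index_chains[OF ij] by auto
  qed
  finally show ?thesis by (simp add: Q_function_alt)
qed

lemma Q_function_1:
  assumes "1 \<le> k"
  shows "Q_function n (Suc 0) k H = (\<Sum>a = k..n. entry H a k)"
proof -
  have "index_chains n 0 = {(\<lambda>_. undefined, \<lambda>_. undefined)}"
    by (auto simp: index_chains_def)
  then have "(\<Sum>c \<in> {c \<in> index_chains n 0. True}. chain_weight H 0 c) = 1"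
    by (simp add: chain_weight_def)
  then show ?thesis
    using Q_function_Suc_aux[OF assms, of n 0 H] by simp
qed

lemma Q_function_Suc:
  assumes "1 \<le> k" "1 \<le> m"
  shows "Q_function n (Suc m) k H =
    (\<Sum>a = k..n. entry H a k * (\<Sum>j \<in> {a<..n}. Q_function n m j H))"
proof -
  have "(\<Sum>j \<in> {a<..n}. Q_function n m j H) =
     (\<Sum>c \<in> {c \<in> index_chains n m. a < snd c 1}. chain_weight H m c)" for a
  proof -
    have *: "snd c 1 \<in> {1..n}" if "c \<in> index_chains n m" for c
      using that assms by (auto simp: index_chains_def PiE_iff)
    have "(\<Sum>c \<in> {c \<in> index_chains n m. a < snd c 1}. chain_weight H m c) =
      (\<Sum>j \<in> {a<..n}. \<Sum>c \<in> {c \<in> {c \<in> index_chains n m. a < snd c 1}. snd c 1 = j}. chain_weight H m c)"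
      by (rule sum.group [symmetric])
        (use * in \<open>auto simp: finite_index_chains\<close>)
    also have "\<dots> = (\<Sum>j \<in> {a<..n}. Q_function n m j H)"
      unfolding Q_function_alt by (intro sum.cong) auto
    finally show ?thesis ..
  qed
  then show ?thesis
    using Q_function_Suc_aux[OF assms(1), of n m H] assms(2) by simp
qed

text \<open>The indices \<open>j r\<close> increase strictly, so \<open>m\<close> of them starting
  at \<open>k\<close> need \<open>k + m - 1 \<le> n\<close>; longer chains do not exist.\<close>

lemma Q_function_eq_0:
  assumes "1 \<le> m" "1 \<le> k" "n + 1 < m + k"
  shows "Q_function n m k H = 0"
  using assms
proof (induction m arbitrary: k rule: nat_induct_at_least)
  case base
  then show ?case by (simp add: Q_function_1)
next
  case (Suc m)
  then show ?case by (auto simp: Q_function_Suc intro!: sum.neutral)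
qed

section \<open>The certificate identity\<close>

text \<open>The form \<open>B\<close> of the overview, cut off at degree \<open>N\<close>. The
  number \<open>(-1)^(l + m) * (l + m choose m)\<close> is the coefficient of \<open>s^l t^m\<close>
  in \<open>1 / (1 + s + t)\<close>.\<close>

definition cert_form :: "nat \<Rightarrow> real poly \<Rightarrow> real poly \<Rightarrow> real" where
  "cert_form N p q = (\<Sum>l<N. \<Sum>m<N. (-1) ^ (l + m) * real ((l + m) choose m) * coeff p l * coeff q m)"

lemma cert_form_add_left: "cert_form N (p + p') q = cert_form N p q + cert_form N p' q"
  by (simp add: cert_form_def sum.distrib algebra_simps)

lemma cert_form_smult_left: "cert_form N (smult c p) q = c * cert_form N p q"
  by (simp add: cert_form_def sum_distrib_left algebra_simps)

lemma cert_form_commute: "cert_form N p q = cert_form N q p"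
proof -
  have "(l + m) choose m = (m + l) choose l" for l m :: nat
    using binomial_symmetric[of m "l + m"] by (simp add: add.commute)
  then show ?thesis
    unfolding cert_form_def by (subst sum.swap) (simp add: algebra_simps)
qed

lemma cert_form_add_right: "cert_form N q (p + p') = cert_form N q p + cert_form N q p'"
  by (metis cert_form_commute cert_form_add_left)

lemma cert_form_smult_right: "cert_form N q (smult c p) = c * cert_form N q p"
  by (metis cert_form_commute cert_form_smult_left)

lemma cert_form_diff_right: "cert_form N q (p - p') = cert_form N q p - cert_form N q p'"
  using cert_form_add_right[of N q "p - p'" p'] by simp

lemma cert_form_0_left: "cert_form N 0 q = 0"
  by (simp add: cert_form_def)

lemma cert_form_sum_left: "cert_form N (\<Sum>k\<in>A. f k) q = (\<Sum>k\<in>A. cert_form N (f k) q)"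
  by (induction A rule: infinite_finite_induct)
    (auto simp: cert_form_add_left cert_form_0_left)

lemma cert_form_sum_right: "cert_form N q (\<Sum>k\<in>A. f k) = (\<Sum>k\<in>A. cert_form N q (f k))"
  by (metis (no_types, lifting) cert_form_commute cert_form_sum_left sum.cong)

lemma cert_form_1_left: "cert_form N 1 p = (\<Sum>m<N. (-1) ^ m * coeff p m)"
proof -
  have "cert_form N 1 p = (\<Sum>l<N. if l = 0 then \<Sum>m<N. (-1) ^ m * coeff p m else 0)"
    unfolding cert_form_def
    by (rule sum.cong) (auto intro!: sum.neutral)
  also have "\<dots> = (\<Sum>m<N. (-1) ^ m * coeff p m)"
    by (cases "N = 0") (auto simp: sum.delta)
  finally show ?thesis .
qed

lemma cert_form_1:
  assumes "degree p < N"
  shows "cert_form N 1 p = poly p (-1)"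
proof -
  have "cert_form N 1 p = (\<Sum>m<N. (-1) ^ m * coeff p m)"
    by (rule cert_form_1_left)
  also have "\<dots> = (\<Sum>m\<le>N - 1. coeff p m * (-1) ^ m)"
    using assms by (intro sum.cong) auto
  also have "\<dots> = poly p (-1)"
    using arg_cong[OF poly_as_sum_of_monoms'[of p "N - 1"], of "\<lambda>p. poly p (-1)"] assms
    by (simp add: poly_sum poly_monom)
  finally show ?thesis .
qed

text \<open>Pascal's rule for \<open>l + m + 2 choose m + 1\<close>; the signs come from the shift
  of one exponent instead of two. The degree bounds make the coefficients lost at the cut-off
  zero.\<close>

lemma cert_form_pCons:
  assumes "degree (pCons 0 p) < N" "degree (pCons 0 q) < N"
  shows "cert_form N (pCons 0 p) (pCons 0 q) =
    - cert_form N p (pCons 0 q) - cert_form N (pCons 0 p) q"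
proof -
  obtain M where N: "N = Suc M" using assms by (cases N) auto
  have c: "coeff p M = 0" "coeff q M = 0"
    using assms coeff_eq_0[of "pCons 0 p" N] coeff_eq_0[of "pCons 0 q" N] by (auto simp: N)
  have "cert_form N (pCons 0 p) (pCons 0 q) = (\<Sum>l<M. \<Sum>m<M.
      (-1) ^ (l + m) * real ((l + m + 2) choose (m + 1)) * coeff p l * coeff q m)"
    by (simp add: cert_form_def N sum.lessThan_Suc_shift del: sum.lessThan_Suc binomial_Suc_Suc)
  moreover have "cert_form N p (pCons 0 q) = (\<Sum>l<M. \<Sum>m<M.
      - ((-1) ^ (l + m) * real ((l + m + 1) choose (m + 1)) * coeff p l * coeff q m))"
    unfolding cert_form_def N by (subst sum.lessThan_Suc, subst (1 2) sum.lessThan_Suc_shift) (simp add: c)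
  moreover have "cert_form N (pCons 0 p) q = (\<Sum>l<M. \<Sum>m<M.
      - ((-1) ^ (l + m) * real ((l + m + 1) choose m) * coeff p l * coeff q m))"
    unfolding cert_form_def N by (subst sum.lessThan_Suc_shift, subst (1 2) sum.lessThan_Suc) (simp add: c)
  ultimately show ?thesis
    by (simp add: sum_negf sum.distrib [symmetric] algebra_simps)
qed

text \<open>This is \<open>((1 + t)^N - 1) / (N t)\<close>. Its constant coefficient 1 is the
  contribution of \<open>q N\<close>.\<close>

definition invariant_poly :: "nat \<Rightarrow> real poly" where
  "invariant_poly N = (\<Sum>m<N. monom (real (N choose Suc m) / real N) m)"

lemma coeff_invariant_poly:
  "coeff (invariant_poly N) m = (if m < N then real (N choose Suc m) / real N else 0)"
  by (simp add: invariant_poly_def coeff_sum)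

text \<open>Negating the upper index absorbs the sign into \<open>(- m - 1) gchoose l\<close>.
  Vandermonde's convolution then gives \<open>(N - 1 - m) choose (N - 1)\<close>, which vanishes
  unless \<open>m = 0\<close>.\<close>

lemma alternating_choose_sum:
  assumes "m < N"
  shows "(\<Sum>l<N. (-1) ^ l * real ((l + m) choose m) * real (N choose Suc l)) = (if m = 0 then 1 else 0)"
proof -
  obtain M where N: "N = Suc M" using assms by (cases N) auto
  have "(- real m - 1) gchoose l = (-1) ^ l * real ((l + m) choose m)" for l
  proof -
    have "(- real m - 1) gchoose l = (-1) ^ l * ((real l - (- real m - 1) - 1) gchoose l)"
      by (rule gbinomial_negated_upper)
    also have "real l - (- real m - 1) - 1 = real (l + m)" by simp
    also have "real (l + m) gchoose l = real ((l + m) choose l)" by (rule binomial_gbinomial [symmetric])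
    also have "(l + m) choose l = (l + m) choose m"
      using binomial_symmetric[of l "l + m"] by simp
    finally show ?thesis .
  qed
  then have "(\<Sum>l<N. (-1) ^ l * real ((l + m) choose m) * real (N choose Suc l)) =
      (\<Sum>l = 0..M. ((- real m - 1) gchoose l) * (real N gchoose (M - l)))"
    unfolding N lessThan_Suc_atMost atMost_atLeast0
    by (intro sum.cong)
      (simp_all flip: binomial_gbinomial add: binomial_symmetric[of "M - _" "Suc M"] Suc_diff_le del: binomial_Suc_Suc of_nat_Suc)
  also have "\<dots> = ((- real m - 1) + real N) gchoose M"
    by (rule gbinomial_Vandermonde)
  also have "(- real m - 1) + real N = real (M - m)"
    using assms by (simp add: N of_nat_diff)
  also have "real (M - m) gchoose M = real ((M - m) choose M)"
    by (rule binomial_gbinomial [symmetric])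
  also have "\<dots> = (if m = 0 then 1 else 0)"
    using assms by (auto simp: N binomial_eq_0_iff)
  finally show ?thesis .
qed

lemma cert_form_invariant_poly:
  assumes "0 < N"
  shows "cert_form N (invariant_poly N) p = coeff p 0 / real N"
proof -
  have "cert_form N (invariant_poly N) p = (\<Sum>m<N. (-1) ^ m * coeff p m / real N *
      (\<Sum>l<N. (-1) ^ l * real ((l + m) choose m) * real (N choose Suc l)))"
    unfolding cert_form_def
    by (subst sum.swap) (simp add: coeff_invariant_poly sum_distrib_left power_add algebra_simps)
  also have "\<dots> = (\<Sum>m<N. if m = 0 then coeff p m / real N else 0)"
    by (intro sum.cong) (auto simp: alternating_choose_sum)
  also have "\<dots> = coeff p 0 / real N"
    using assms by (subst sum.delta) auto
  finally show ?thesis .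
qed

text \<open>One coordinate of the algorithm with its recursion unrolled: \<open>ppm_center\<close>
  at \<open>k\<close> is \<open>y_k\<close>, and \<open>ppm_point\<close> at
  \<open>k \<ge> 1\<close> is \<open>x_k\<close>. The updates act coordinatewise, so the algebra can
  be done on real numbers.\<close>

definition ppm_center :: "(nat \<Rightarrow> nat \<Rightarrow> real) \<Rightarrow> real \<Rightarrow> (nat \<Rightarrow> real) \<Rightarrow> nat \<Rightarrow> real" where
  "ppm_center h y g k = y - 2 * (\<Sum>a = 1..k. \<Sum>l = 1..a. h a l * g l)"

definition ppm_point :: "(nat \<Rightarrow> nat \<Rightarrow> real) \<Rightarrow> real \<Rightarrow> (nat \<Rightarrow> real) \<Rightarrow> nat \<Rightarrow> real" where
  "ppm_point h y g k = ppm_center h y g (k - 1) - g k"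

lemma sum_swap_less:
  fixes f :: "nat \<Rightarrow> nat \<Rightarrow> 'a :: comm_monoid_add"
  shows "(\<Sum>k = 1..N. \<Sum>a = 1..k - 1. f k a) = (\<Sum>a = 1..<N. \<Sum>k \<in> {a<..N}. f k a)"
proof -
  have "(\<Sum>k = 1..N. \<Sum>a = 1..k - 1. f k a) = (\<Sum>k \<in> {1..N}. \<Sum>a \<in> {a \<in> {1..<N}. a < k}. f k a)"
    by (intro sum.cong) auto
  also have "\<dots> = (\<Sum>a \<in> {1..<N}. \<Sum>k \<in> {k \<in> {1..N}. a < k}. f k a)"
    by (rule sum.swap_restrict) auto
  also have "\<dots> = (\<Sum>a = 1..<N. \<Sum>k \<in> {a<..N}. f k a)"
    by (intro sum.cong) auto
  finally show ?thesis .
qed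

lemma sum_swap_le:
  fixes f :: "nat \<Rightarrow> nat \<Rightarrow> 'a :: comm_monoid_add"
  shows "(\<Sum>a = 1..<N. \<Sum>l = 1..a. f a l) = (\<Sum>l = 1..<N. \<Sum>a \<in> {l..<N}. f a l)"
proof -
  have "(\<Sum>a = 1..<N. \<Sum>l = 1..a. f a l) = (\<Sum>a \<in> {1..<N}. \<Sum>l \<in> {l \<in> {1..<N}. l \<le> a}. f a l)"
    by (intro sum.cong) auto
  also have "\<dots> = (\<Sum>l \<in> {1..<N}. \<Sum>a \<in> {a \<in> {1..<N}. l \<le> a}. f a l)"
    by (rule sum.swap_restrict) auto
  also have "\<dots> = (\<Sum>l = 1..<N. \<Sum>a \<in> {l..<N}. f a l)"
    by (intro sum.cong) auto
  finally show ?thesis .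
qed

text \<open>The weighted sum is the quadratic form of a graph Laplacian.\<close>

lemma sum_pairs_laplacian:
  fixes M :: "nat \<Rightarrow> nat \<Rightarrow> real"
  assumes sym: "\<And>k j. M k j = M j k"
  shows "(\<Sum>k = 1..N. \<Sum>j = 1..k - 1. M k j * ((g k - g j) * (x k - x j))) =
    (\<Sum>k = 1..N. (\<Sum>j = 1..N. M k j) * (g k * x k)) - (\<Sum>k = 1..N. \<Sum>j = 1..N. M k j * (g k * x j))"
proof (induction N)
  case (Suc N)
  have "(\<Sum>k = 1..N. M k (Suc N) * (g k * x k)) + (\<Sum>j = 1..N. M (Suc N) j) * (g (Suc N) * x (Suc N))
     - (\<Sum>k = 1..N. M k (Suc N) * (g k * x (Suc N))) - (\<Sum>j = 1..N. M (Suc N) j * (g (Suc N) * x j))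
     = (\<Sum>j = 1..N. M (Suc N) j * ((g (Suc N) - g j) * (x (Suc N) - x j)))"
    unfolding sym[of _ "Suc N"] sum_distrib_right sum_subtractf [symmetric] sum.distrib [symmetric]
    by (intro sum.cong) (auto simp: algebra_simps)
  then show ?case
    using Suc by (simp add: sum.distrib distrib_right algebra_simps)
qed simp

text \<open>The recursion \<open>q_rec\<close> prepends a pair \<open>(a, k)\<close> to the chains
  starting beyond \<open>a\<close>: the factor \<open>t\<close> counts the new pair, and the summand
  \<open>q N = 1\<close> stands for a chain that ends there.\<close>

locale certificate_polys =
  fixes N :: nat and h :: "nat \<Rightarrow> nat \<Rightarrow> real" and q :: "nat \<Rightarrow> real poly"
  assumes N_pos: "0 < N"
    and q_N: "q N = 1"
    and q_rec: "\<And>k. k \<in> {1..<N} \<Longrightarrow>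
      q k = pCons 0 (\<Sum>a \<in> {k..<N}. smult (h a k) (\<Sum>j \<in> {a<..N}. q j))"
    and degree_q: "\<And>k. degree (q k) < N"
begin

text \<open>The Laplacian formula reduces the sum to row sums, which pair \<open>q k\<close> with
  the invariant polynomial, and to the single value \<open>cert_form N a X\<close>, where
  \<open>a\<close> and \<open>X\<close> collect the gradients and the points with weights
  \<open>q k\<close>.\<close>

lemma certificate_sum:
  fixes y :: real and g :: "nat \<Rightarrow> real"
  assumes inv: "(\<Sum>k = 1..N. q k) = invariant_poly N"
  defines "x \<equiv> ppm_point h y g"
  shows "(\<Sum>k = 1..N. \<Sum>j = 1..k - 1. - real N * cert_form N (q k) (q j) * ((g k - g j) * (x k - x j)))
    = g N * (y - x N - real N * g N)"
proof -
  define a where "a = (\<Sum>k = 1..N. smult (g k) (q k))"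
  \<comment> \<open>By \<open>q_rec\<close>, \<open>a = g N + t * r\<close>. The same
    \<open>r\<close> collects the accumulated steps inside the points, so \<open>X\<close> is
    expressible through \<open>a\<close> and \<open>r\<close>.\<close>
  define r where "r = (\<Sum>l = 1..<N. smult (g l) (\<Sum>a \<in> {l..<N}. smult (h a l) (\<Sum>j \<in> {a<..N}. q j)))"
  define X where "X = (\<Sum>k = 1..N. smult (x k) (q k))"
  have atMost: "{1..N} = insert N {1..<N}" using N_pos by auto
  have pC: "pCons 0 (\<Sum>k\<in>A. f k) = (\<Sum>k\<in>A. pCons 0 (f k :: real poly))" for A :: "nat set" and f
    by (rule poly_eqI) (simp add: coeff_sum coeff_pCons split: nat.split)
  have "(\<Sum>k = 1..<N. smult (g k) (q k)) = pCons 0 r"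
    unfolding r_def pC by (rule sum.cong) (auto simp: q_rec)
  then have a: "a = [:g N:] + pCons 0 r"
    unfolding a_def atMost by (simp add: q_N)
  have "degree a < N"
    unfolding a_def using N_pos
    by (intro degree_sum_less) (auto intro: le_less_trans[OF degree_smult_le] degree_q)
  moreover have "pCons 0 r = a - [:g N:]" by (simp add: a)
  moreover have "degree [:g N:] < N" using N_pos by simp
  ultimately have deg: "degree (pCons 0 r) < N"
    by (metis degree_diff_less)
  have smult_sum2: "smult c (\<Sum>k\<in>A. f k) = (\<Sum>k\<in>A. smult c (f k :: real poly))" for c A and f :: "nat \<Rightarrow> _"
    by (rule poly_eqI) (simp add: coeff_sum sum_distrib_left)
  \<comment> \<open>Exchange the order of summation: the step \<open>h a l * g l\<close> reaches
    exactly the points with index \<open>k > a\<close>, which produces the inner sum of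
    \<open>q_rec\<close>.\<close>
  have X: "X = smult y (invariant_poly N) - a - smult 2 r"
  proof -
    have "(\<Sum>k = 1..N. smult (\<Sum>a = 1..k - 1. \<Sum>l = 1..a. h a l * g l) (q k)) =
       (\<Sum>k = 1..N. \<Sum>a = 1..k - 1. \<Sum>l = 1..a. smult (h a l * g l) (q k))"
      by (simp add: smult_sum)
    also have "\<dots> = (\<Sum>a = 1..<N. \<Sum>k \<in> {a<..N}. \<Sum>l = 1..a. smult (h a l * g l) (q k))"
      by (rule sum_swap_less)
    also have "\<dots> = (\<Sum>a = 1..<N. \<Sum>l = 1..a. \<Sum>k \<in> {a<..N}. smult (h a l * g l) (q k))"
      by (intro sum.cong sum.swap refl)
    also have "\<dots> = (\<Sum>l = 1..<N. \<Sum>a \<in> {l..<N}. \<Sum>k \<in> {a<..N}. smult (h a l * g l) (q k))"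
      by (rule sum_swap_le)
    also have "\<dots> = r"
      unfolding r_def by (simp add: smult_sum2 mult.commute)
    finally have r: "(\<Sum>k = 1..N. smult (\<Sum>a = 1..k - 1. \<Sum>l = 1..a. h a l * g l) (q k)) = r" .
    have "X = (\<Sum>k = 1..N. smult y (q k) - smult (g k) (q k)
        - smult 2 (smult (\<Sum>a = 1..k - 1. \<Sum>l = 1..a. h a l * g l) (q k)))"
      unfolding X_def x_def ppm_point_def ppm_center_def
      by (intro sum.cong) (auto simp: smult_diff_left smult_add_left algebra_simps)
    also have "\<dots> = smult y (invariant_poly N) - a - smult 2 r"
      by (simp only: sum_subtractf smult_sum2 [symmetric] inv a_def r)
    finally show ?thesis .
  qed
  have row: "(\<Sum>j = 1..N. cert_form N (q k) (q j)) = coeff (q k) 0 / real N" for k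
  proof -
    have "(\<Sum>j = 1..N. cert_form N (q k) (q j)) = cert_form N (\<Sum>j = 1..N. q j) (q k)"
      unfolding cert_form_sum_left by (intro sum.cong refl cert_form_commute)
    then show ?thesis
      by (simp only: inv cert_form_invariant_poly N_pos)
  qed
  \<comment> \<open>Only \<open>q N\<close> has a constant term, so only the last row sum
    survives.\<close>
  have q0: "coeff (q k) 0 = (if k = N then 1 else 0)" if "k \<in> {1..N}" for k
  proof (cases "k = N")
    case False
    then show ?thesis using that by (subst q_rec) auto
  qed (simp add: q_N)
  \<comment> \<open>The mixed terms cancel because pairing with 1 is evaluation at
    \<open>-1\<close>, where \<open>r\<close> and \<open>t * r\<close> have opposite values. The
    terms quadratic in \<open>r\<close> cancel by Pascal's rule.\<close>
  have aa: "cert_form N a (a + smult 2 r) = g N ^ 2"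
  proof -
    have "degree r < N" using deg by (cases "r = 0") auto
    then have 1: "cert_form N 1 r + cert_form N 1 (pCons 0 r) = 0"
      using deg by (simp add: cert_form_1)
    have a': "a = smult (g N) 1 + pCons 0 r" by (simp add: a one_pCons)
    have "cert_form N 1 1 = 1" by (simp add: cert_form_1 N_pos)
    then have "cert_form N a (a + smult 2 r) = g N ^ 2 + 2 * g N * (cert_form N 1 r + cert_form N 1 (pCons 0 r))
        + (cert_form N (pCons 0 r) (pCons 0 r) + 2 * cert_form N (pCons 0 r) r)"
      unfolding a' cert_form_add_left cert_form_add_right cert_form_smult_left cert_form_smult_right
      by (simp add: cert_form_commute[of N "pCons 0 r" 1] power2_eq_square algebra_simps)
    also have "\<dots> = g N ^ 2"
      unfolding 1 cert_form_pCons[OF deg deg] cert_form_commute[of N r] by simp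
    finally show ?thesis .
  qed
  have aX: "cert_form N a X = g N * y / real N - g N ^ 2"
  proof -
    have "cert_form N a (invariant_poly N) = g N / real N"
      by (subst cert_form_commute) (simp add: cert_form_invariant_poly N_pos a)
    then have "cert_form N a X = y * (g N / real N) - cert_form N a (a + smult 2 r)"
      unfolding X cert_form_diff_right cert_form_add_right cert_form_smult_right by simp
    then show ?thesis by (simp add: aa)
  qed
  have "(\<Sum>k = 1..N. \<Sum>j = 1..k - 1. cert_form N (q k) (q j) * ((g k - g j) * (x k - x j)))
    = (\<Sum>k = 1..N. (\<Sum>j = 1..N. cert_form N (q k) (q j)) * (g k * x k))
      - (\<Sum>k = 1..N. \<Sum>j = 1..N. cert_form N (q k) (q j) * (g k * x j))"
    by (rule sum_pairs_laplacian) (rule cert_form_commute)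
  also have "(\<Sum>k = 1..N. (\<Sum>j = 1..N. cert_form N (q k) (q j)) * (g k * x k)) =
      (\<Sum>k = 1..N. if k = N then g k * x k / real N else 0)"
    unfolding row by (intro sum.cong) (auto simp: q0)
  also have "\<dots> = g N * x N / real N"
    using N_pos by (subst sum.delta) auto
  also have "(\<Sum>k = 1..N. \<Sum>j = 1..N. cert_form N (q k) (q j) * (g k * x j)) = cert_form N a X"
    unfolding a_def X_def cert_form_sum_left cert_form_smult_left
    unfolding cert_form_sum_right cert_form_smult_right
    by (simp add: sum_distrib_left algebra_simps)
  finally have main: "(\<Sum>k = 1..N. \<Sum>j = 1..k - 1. cert_form N (q k) (q j) * ((g k - g j) * (x k - x j)))
    = g N * x N / real N - (g N * y / real N - g N ^ 2)"
    by (simp only: aX)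
  have "(\<Sum>k = 1..N. \<Sum>j = 1..k - 1. - real N * cert_form N (q k) (q j) * ((g k - g j) * (x k - x j)))
    = - real N * (\<Sum>k = 1..N. \<Sum>j = 1..k - 1. cert_form N (q k) (q j) * ((g k - g j) * (x k - x j)))"
    by (simp only: sum_distrib_left mult.assoc)
  also have "\<dots> = g N * (y - x N - real N * g N)"
    unfolding main using N_pos by (simp add: power2_eq_square field_simps)
  finally show ?thesis .
qed

end

section \<open>Generating polynomials of the Q-functions\<close>

definition Q_poly :: "nat \<Rightarrow> real mat \<Rightarrow> nat \<Rightarrow> real poly" where
  "Q_poly N H k = (if k = N then 1 else \<Sum>m = 1..<N. monom (Q_function (N - 1) m k H) m)"

lemma coeff_Q_poly:
  "coeff (Q_poly N H k) m =
     (if k = N then (if m = 0 then 1 else 0)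
      else if 1 \<le> m \<and> m < N then Q_function (N - 1) m k H else 0)"
  by (auto simp: Q_poly_def coeff_sum)

lemma degree_Q_poly: "0 < N \<Longrightarrow> degree (Q_poly N H k) < N"
  by (intro degree_lessI) (auto simp: coeff_Q_poly)

lemma Q_poly_rec:
  assumes "k \<in> {1..<N}"
  shows "Q_poly N H k =
    pCons 0 (\<Sum>a \<in> {k..<N}. smult (entry H a k) (\<Sum>j \<in> {a<..N}. Q_poly N H j))"
proof (rule poly_eqI)
  fix m
  have split: "{a<..N} = insert N {a<..N - 1}" if "a \<in> {k..<N}" for a
    using that by auto
  have ivl: "{k..N - Suc 0} = {k..<N}" using assms by auto
  show "coeff (Q_poly N H k) m =
    coeff (pCons 0 (\<Sum>a \<in> {k..<N}. smult (entry H a k) (\<Sum>j \<in> {a<..N}. Q_poly N H j))) m"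
  proof (cases m)
    case 0
    then show ?thesis using assms by (simp add: coeff_Q_poly)
  next
    case (Suc l)
    have inner: "(\<Sum>j \<in> {a<..N}. coeff (Q_poly N H j) l) =
        (if l = 0 then 1 else if l < N then \<Sum>j \<in> {a<..N - 1}. Q_function (N - 1) l j H else 0)"
      if a: "a \<in> {k..<N}" for a
    proof -
      have "(\<Sum>j \<in> {a<..N}. coeff (Q_poly N H j) l) =
          (if l = 0 then 1 else 0) + (\<Sum>j \<in> {a<..N - 1}. coeff (Q_poly N H j) l)"
        using a by (subst split[OF a], subst sum.insert) (auto simp: coeff_Q_poly)
      also have "(\<Sum>j \<in> {a<..N - 1}. coeff (Q_poly N H j) l) =
          (\<Sum>j \<in> {a<..N - 1}. if 1 \<le> l \<and> l < N then Q_function (N - 1) l j H else 0)"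
        by (intro sum.cong) (auto simp: coeff_Q_poly)
      finally show ?thesis by auto
    qed
    have rhs: "coeff (pCons 0 (\<Sum>a \<in> {k..<N}. smult (entry H a k) (\<Sum>j \<in> {a<..N}. Q_poly N H j))) m
      = (\<Sum>a \<in> {k..<N}. entry H a k * (if l = 0 then 1 else if l < N then
           \<Sum>j \<in> {a<..N - 1}. Q_function (N - 1) l j H else 0))"
      by (simp add: Suc coeff_sum inner)
    \<comment> \<open>For \<open>l = 0\<close> only the summand \<open>j = N\<close> contributes.
      For \<open>Suc l \<ge> N\<close> the left side is cut off, and on the right a chain of length
      \<open>l\<close> starting beyond \<open>a \<ge> 1\<close> does not fit.\<close>
    consider "l = 0" | "1 \<le> l" "Suc l < N" | "1 \<le> l" "N \<le> Suc l" by linarith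
    then show ?thesis
    proof cases
      case 1
      then show ?thesis
        unfolding rhs using assms by (auto simp: Suc coeff_Q_poly Q_function_1 ivl)
    next
      case 2
      then show ?thesis
        unfolding rhs using assms by (simp add: Suc coeff_Q_poly Q_function_Suc ivl)
    next
      case 3
      then have "(\<Sum>j \<in> {a<..N - 1}. Q_function (N - 1) l j H) = 0" if "a \<in> {k..<N}" for a
        using that assms by (intro sum.neutral) (auto intro!: Q_function_eq_0)
      then have "coeff (pCons 0 (\<Sum>a \<in> {k..<N}. smult (entry H a k) (\<Sum>j \<in> {a<..N}. Q_poly N H j))) m = 0"
        unfolding rhs using 3 by (intro sum.neutral ballI) simp
      moreover have "coeff (Q_poly N H k) m = 0"
        using 3 assms by (auto simp: Suc coeff_Q_poly)
      ultimately show ?thesis by (simp only:)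
    qed
  qed
qed

lemma certificate_polys_Q_poly: "0 < N \<Longrightarrow> certificate_polys N (entry H) (Q_poly N H)"
  by unfold_locales (auto simp: Q_poly_rec degree_Q_poly, simp add: Q_poly_def)

text \<open>Grouping chains by their first index makes the coefficient of \<open>t^m\<close> the
  \<open>m\<close>-th invariant for \<open>m \<ge> 1\<close>; the constant coefficients are both
  1.\<close>

lemma sum_Q_poly_eq_invariant_poly_iff:
  assumes "0 < N"
  shows "(\<Sum>k = 1..N. Q_poly N H k) = invariant_poly N \<longleftrightarrow>
    (\<forall>m \<in> {1..N - 1}. H_invariant (N - 1) m H = 1 / real N * real (N choose (m + 1)))"
proof -
  have ivl: "{1..N} = insert N {1..N - 1}" using assms by auto
  have coeff: "coeff (\<Sum>k = 1..N. Q_poly N H k) m =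
      (if m = 0 then 1 else if m < N then H_invariant (N - 1) m H else 0)" for m
  proof -
    have "coeff (\<Sum>k = 1..N. Q_poly N H k) m =
      (if m = 0 then 1 else 0) + (\<Sum>k = 1..N - 1. coeff (Q_poly N H k) m)"
      unfolding ivl coeff_sum using assms by (subst sum.insert) (auto simp: coeff_Q_poly)
    also have "(\<Sum>k = 1..N - 1. coeff (Q_poly N H k) m) =
      (\<Sum>k = 1..N - 1. if 1 \<le> m \<and> m < N then Q_function (N - 1) m k H else 0)"
      by (intro sum.cong) (use assms in \<open>auto simp: coeff_Q_poly\<close>)
    also have "\<dots> = (if 1 \<le> m \<and> m < N then H_invariant (N - 1) m H else 0)"
      by (auto simp: H_invariant_eq_sum_Q_function)
    finally show ?thesis by auto
  qed
  show ?thesis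
    unfolding poly_eq_iff coeff coeff_invariant_poly using assms
    by (auto simp del: binomial_Suc_Suc)
qed

text \<open>The ranges \<open>1..N - j\<close> and \<open>1..N - k\<close> extend to all exponents
  below \<open>N\<close>, since the constant coefficients vanish and longer chains do not exist. The
  separate formula for \<open>k = N\<close> is the case \<open>q N = 1\<close> of the same
  form.\<close>

lemma H_certificate_eq_cert_form:
  assumes "1 \<le> j" "j < k" "k \<le> N"
  shows "H_certificate N k j H = - real N * cert_form N (Q_poly N H k) (Q_poly N H j)"
proof -
  have extend: "(\<Sum>m = 1..N - i. f m * Q_function (N - 1) m i H) =
      (\<Sum>m<N. f m * coeff (Q_poly N H i) m)" if "1 \<le> i" "i < N" for i and f :: "nat \<Rightarrow> real"
    using that by (intro sum.mono_neutral_cong_left) (auto simp: coeff_Q_poly Q_function_eq_0)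
  have sgn: "(-1) ^ (m - Suc 0) = - ((-1 :: real) ^ m)" if "1 \<le> m" for m
    using that by (cases m) auto
  show ?thesis
  proof (cases "k = N")
    case True
    have "(\<Sum>m = 1..N - j. (-1) ^ (m - 1) * Q_function (N - 1) m j H) =
       - (\<Sum>m = 1..N - j. (-1) ^ m * Q_function (N - 1) m j H)"
      unfolding sum_negf [symmetric] by (intro sum.cong) (auto simp: sgn)
    also have "\<dots> = - cert_form N 1 (Q_poly N H j)"
      using assms True by (subst extend) (auto simp: cert_form_1_left)
    finally show ?thesis
      using True by (simp add: H_certificate_def Q_poly_def)
  next
    case False
    have "(\<Sum>l = 1..N - j. \<Sum>m = 1..N - k. (-1) ^ (l + m - 1) * real ((l + m) choose m) *
             Q_function (N - 1) l j H * Q_function (N - 1) m k H)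
       = - (\<Sum>l = 1..N - j. (\<Sum>m = 1..N - k. ((-1) ^ (l + m) * real ((l + m) choose m)) *
              Q_function (N - 1) m k H) * Q_function (N - 1) l j H)"
      unfolding sum_negf [symmetric] sum_distrib_right by (intro sum.cong) (auto simp: sgn)
    also have "\<dots> = - cert_form N (Q_poly N H j) (Q_poly N H k)"
      using assms False by (subst (1 2) extend) (auto simp: cert_form_def sum_distrib_left sum_distrib_right algebra_simps)
    finally show ?thesis
      using False by (simp add: H_certificate_def cert_form_commute[of N "Q_poly N H k"])
  qed
qed

section \<open>Maximally monotone operators and finite data\<close>

text \<open>Monotonicity is a condition on pairs of graph points, and two points of the union of a
  chain lie in a common member, so Zorn's lemma applies.\<close>

lemma ex_maximally_monotone_extension:
  assumes "monotone_operator d B"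
  shows "\<exists>A. B \<subseteq> A \<and> maximally_monotone d A"
proof -
  let ?F = "{A. monotone_operator d A \<and> B \<subseteq> A}"
  have "\<exists>A \<in> ?F. \<forall>X \<in> ?F. A \<subseteq> X \<longrightarrow> X = A"
  proof (rule subset_Zorn_nonempty)
    fix C assume C: "C \<noteq> {}" "subset.chain ?F C"
    then have sub: "\<And>X. X \<in> C \<Longrightarrow> monotone_operator d X \<and> B \<subseteq> X"
      and chain: "\<And>X Y. X \<in> C \<Longrightarrow> Y \<in> C \<Longrightarrow> X \<subseteq> Y \<or> Y \<subseteq> X"
      unfolding subset.chain_def by blast+
    have "\<exists>X \<in> C. a \<in> X \<and> b \<in> X" if "a \<in> \<Union>C" "b \<in> \<Union>C" for a b
      using that chain by (meson UnionE subsetD)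
    then have "case a of (x, u) \<Rightarrow> case b of (y, v) \<Rightarrow> 0 \<le> (u - v) \<bullet> (x - y)"
      if "a \<in> \<Union>C" "b \<in> \<Union>C" for a b
      using that sub unfolding monotone_operator_def by blast
    moreover have "\<Union>C \<subseteq> carrier_vec d \<times> carrier_vec d"
      using sub unfolding monotone_operator_def by blast
    ultimately have "monotone_operator d (\<Union>C)"
      unfolding monotone_operator_def by blast
    then show "\<Union>C \<in> ?F" using C(1) sub by blast
  qed (use assms in auto)
  then obtain A where A: "monotone_operator d A" "B \<subseteq> A"
      "\<And>X. monotone_operator d X \<Longrightarrow> B \<subseteq> X \<Longrightarrow> A \<subseteq> X \<Longrightarrow> X = A"
    by auto
  have "maximally_monotone d A"
    unfolding maximally_monotone_def
  proof (intro conjI allI impI)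
    fix X assume "monotone_operator d X \<and> A \<subseteq> X"
    then show "X = A" using A(2) by (intro A(3)) auto
  qed (rule A(1))
  then show ?thesis using A(2) by blast
qed

text \<open>Two graph points with equal sum satisfy \<open>u - u' = - (x - x')\<close>, and
  monotonicity makes minus the squared norm of \<open>x - x'\<close> nonnegative.\<close>

lemma resolvent_image_eq:
  assumes A: "monotone_operator d A" and xu: "(x, u) \<in> A"
  shows "resolvent A `` {x + u} = {x}"
proof -
  have xu_c: "x \<in> carrier_vec d" "u \<in> carrier_vec d"
    using A xu by (auto simp: monotone_operator_def)
  have "x' = x" if x': "(x', u') \<in> A" "x' + u' = x + u" for x' u'
  proof -
    have c: "x' \<in> carrier_vec d" "u' \<in> carrier_vec d"
      using A x' by (auto simp: monotone_operator_def)
    have d: "u - u' = - (x - x')"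
    proof (rule eq_vecI)
      fix i assume i: "i < dim_vec (- (x - x'))"
      have "(x' + u') $ i = (x + u) $ i" by (simp add: x')
      then show "(u - u') $ i = (- (x - x')) $ i" using i c xu_c by auto
    qed (use c xu_c in auto)
    have "0 \<le> (u - u') \<bullet> (x - x')"
      using A xu x' unfolding monotone_operator_def by blast
    then have "0 \<le> - ((x - x') \<bullet> (x - x'))"
      unfolding d using c xu_c by simp
    then have "(\<Sum>i<d. (x $ i - x' $ i) ^ 2) \<le> 0"
      using c xu_c by (simp add: scalar_prod_def power2_eq_square atLeast0LessThan)
    then have "(\<Sum>i<d. (x $ i - x' $ i) ^ 2) = 0"
      by (intro antisym sum_nonneg) auto
    then have "\<forall>i<d. x $ i = x' $ i" by (subst (asm) sum_nonneg_eq_0_iff) auto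
    then show "x' = x" using c xu_c by (intro eq_vecI) auto
  qed
  then show ?thesis using xu by (auto simp: resolvent_def)
qed

text \<open>The zero of the operator is normalised to be the origin.\<close>

definition ppm_data :: "nat \<Rightarrow> (nat \<Rightarrow> nat \<Rightarrow> real) \<Rightarrow> nat \<Rightarrow> (nat \<Rightarrow> real) \<Rightarrow> (nat \<Rightarrow> nat \<Rightarrow> real) \<Rightarrow> bool" where
  "ppm_data N h d y g \<longleftrightarrow>
     (\<forall>k \<in> {1..N}. \<forall>j \<in> {1..<k}. 0 \<le> (\<Sum>i<d. (g k i - g j i) *
        (ppm_point h (y i) (\<lambda>l. g l i) k - ppm_point h (y i) (\<lambda>l. g l i) j))) \<and>
     (\<forall>k \<in> {1..N}. 0 \<le> (\<Sum>i<d. g k i * ppm_point h (y i) (\<lambda>l. g l i) k))"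

text \<open>Reduces the rate over all operators to finite systems of inequalities. Subtracting the
  zero \<open>ys\<close> from the start translates all points by the same vector and leaves the
  gradients unchanged.\<close>

lemma achieves_optimal_rateI:
  assumes N: "0 < N"
    and data: "\<And>d y g. ppm_data N (entry H) d y g \<Longrightarrow> (real N)\<^sup>2 * (\<Sum>i<d. (g N i)\<^sup>2) \<le> (\<Sum>i<d. (y i)\<^sup>2)"
  shows "achieves_optimal_rate N H"
  unfolding achieves_optimal_rate_def
proof (intro allI impI, elim conjE)
  fix d A ys x g y
  assume A: "maximally_monotone d A" "(ys, 0\<^sub>v d) \<in> A" and it: "ppm_iterates N H d A x g y"
  have mono: "monotone_operator d A" using A by (simp add: maximally_monotone_def)
  then have ys: "ys \<in> carrier_vec d" using A by (auto simp: monotone_operator_def)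
  \<comment> \<open>Only \<open>y 0\<close> has a prescribed carrier. For the other vectors it
    follows from the resolvent, whose pairs come from the graph of \<open>A\<close>.\<close>
  have gr: "(x k, g k) \<in> A \<and> y (k - 1) \<in> carrier_vec d \<and> x k = y (k - 1) - g k" if k: "k \<in> {1..N}" for k
  proof -
    have k1: "k - 1 < N" "k - 1 + 1 = k" using k by auto
    then have r: "resolvent A `` {y (k - 1)} = {x k}" "g k = y (k - 1) - x k"
      using it unfolding ppm_iterates_def by metis+
    then have "(y (k - 1), x k) \<in> resolvent A" by auto
    then obtain u where u: "(x k, u) \<in> A" "y (k - 1) = x k + u"
      by (auto simp: resolvent_def)
    then have c: "x k \<in> carrier_vec d" "u \<in> carrier_vec d"
      using mono by (auto simp: monotone_operator_def)
    have "u = g k" unfolding r(2) u(2) using c by (intro eq_vecI) auto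
    moreover have "x k = y (k - 1) - u"
      unfolding u(2) using c by (intro eq_vecI) auto
    moreover have "y (k - 1) \<in> carrier_vec d"
      unfolding u(2) using c by simp
    ultimately show ?thesis using u(1) by simp
  qed
  have xg: "x k \<in> carrier_vec d" "g k \<in> carrier_vec d" if "k \<in> {1..N}" for k
    using gr[OF that] mono by (auto simp: monotone_operator_def)
  let ?z = "\<lambda>i. y 0 $ i - ys $ i"
  have yk: "y k $ i = ppm_center (entry H) (y 0 $ i) (\<lambda>l. g l $ i) k" if "i < d" "k \<le> N - 1" for k i
    using that(2)
  proof (induction k)
    case (Suc k)
    let ?s = "\<lambda>j. (2 * entry H (k + 1) (j + 1)) \<cdot>\<^sub>v g (j + 1)"
    have s: "?s \<in> {0..k} \<rightarrow> carrier_vec d" using xg Suc.prems by auto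
    have "y (Suc k) = y k - finsum_vec TYPE(real) d ?s {0..k}"
      using it Suc.prems unfolding ppm_iterates_def by simp
    then have "y (Suc k) $ i = y k $ i - (\<Sum>j = 0..k. ?s j $ i)"
      using that(1) index_finsum_vec[OF finite_atLeastAtMost that(1) s] finsum_vec_closed[OF s]
      by simp
    also have "(\<Sum>j = 0..k. ?s j $ i) = (\<Sum>j = 0..k. 2 * entry H (Suc k) (Suc j) * g (Suc j) $ i)"
    proof (rule sum.cong)
      fix j assume "j \<in> {0..k}"
      then have "g (Suc j) \<in> carrier_vec d" using xg[of "Suc j"] Suc.prems by simp
      then show "?s j $ i = 2 * entry H (Suc k) (Suc j) * g (Suc j) $ i" using that(1) by simp
    qed simp
    also have "\<dots> = (\<Sum>l = 1..Suc k. 2 * entry H (Suc k) l * g l $ i)"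
      unfolding One_nat_def sum.shift_bounds_cl_Suc_ivl ..
    finally show ?case
      using Suc by (simp add: ppm_center_def sum_distrib_left algebra_simps)
  qed (simp add: ppm_center_def)
  have xk: "x k $ i - ys $ i = ppm_point (entry H) (?z i) (\<lambda>l. g l $ i) k" if "i < d" "k \<in> {1..N}" for k i
  proof -
    have 1: "x k = y (k - 1) - g k" "y (k - 1) \<in> carrier_vec d" using gr[OF that(2)] by simp_all
    have "x k $ i = y (k - 1) $ i - g k $ i"
      unfolding 1(1) using 1(2) xg[OF that(2)] that(1) by simp
    moreover have "y (k - 1) $ i = ppm_center (entry H) (y 0 $ i) (\<lambda>l. g l $ i) (k - 1)"
      by (rule yk) (use that in auto)
    ultimately show ?thesis
      unfolding ppm_point_def ppm_center_def by linarith
  qed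
  have "ppm_data N (entry H) d ?z (\<lambda>k i. g k $ i)"
    unfolding ppm_data_def
  proof (intro conjI ballI)
    fix k j assume k: "k \<in> {1..N}" and "j \<in> {1..<k}"
    then have j: "j \<in> {1..N}" by auto
    have "0 \<le> (g k - g j) \<bullet> (x k - x j)"
      using mono gr[OF k] gr[OF j] unfolding monotone_operator_def by blast
    also have "\<dots> = (\<Sum>i<d. (g k $ i - g j $ i) * ((x k $ i - ys $ i) - (x j $ i - ys $ i)))"
      using xg[OF k] xg[OF j] by (simp add: scalar_prod_def atLeast0LessThan)
    also have "\<dots> = (\<Sum>i<d. (g k $ i - g j $ i) *
        (ppm_point (entry H) (?z i) (\<lambda>l. g l $ i) k - ppm_point (entry H) (?z i) (\<lambda>l. g l $ i) j))"
      using k j by (intro sum.cong) (auto simp: xk)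
    finally show "0 \<le> \<dots>" .
  next
    fix k assume k: "k \<in> {1..N}"
    have "0 \<le> (g k - 0\<^sub>v d) \<bullet> (x k - ys)"
      using mono gr[OF k] A unfolding monotone_operator_def by blast
    also have "\<dots> = (\<Sum>i<d. g k $ i * (x k $ i - ys $ i))"
      using xg[OF k] ys by (simp add: scalar_prod_def atLeast0LessThan)
    also have "\<dots> = (\<Sum>i<d. g k $ i * ppm_point (entry H) (?z i) (\<lambda>l. g l $ i) k)"
      using k by (intro sum.cong) (auto simp: xk)
    finally show "0 \<le> \<dots>" .
  qed
  then have rate: "(real N)\<^sup>2 * (\<Sum>i<d. (g N $ i)\<^sup>2) \<le> (\<Sum>i<d. (y 0 $ i - ys $ i)\<^sup>2)"
    by (rule data)
  have "sq_norm_v (g N) = (\<Sum>i<d. (g N $ i)\<^sup>2)"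
    using xg[of N] N by (simp add: sq_norm_v_def scalar_prod_def atLeast0LessThan power2_eq_square)
  moreover have "sq_norm_v (y 0 - ys) = (\<Sum>i<d. (y 0 $ i - ys $ i)\<^sup>2)"
    using ys by (simp add: sq_norm_v_def scalar_prod_def atLeast0LessThan power2_eq_square)
  ultimately have "(real N)\<^sup>2 * sq_norm_v (g N) \<le> sq_norm_v (y 0 - ys)"
    using rate by simp
  then show "sq_norm_v (g N) \<le> sq_norm_v (y 0 - ys) / (real N)\<^sup>2"
    using N by (simp add: field_simps)
qed

text \<open>The points and gradients together with the pair of origins form a finite monotone graph.
  On a maximal extension the resolvent is forced at each center, so the algorithm runs through
  exactly these data.\<close>

lemma achieves_optimal_rateD:
  assumes rate: "achieves_optimal_rate N H" and N: "0 < N" and d: "1 \<le> d"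
    and data: "ppm_data N (entry H) d y g"
  shows "(real N)\<^sup>2 * (\<Sum>i<d. (g N i)\<^sup>2) \<le> (\<Sum>i<d. (y i)\<^sup>2)"
proof -
  let ?x = "\<lambda>k. vec d (\<lambda>i. ppm_point (entry H) (y i) (\<lambda>l. g l i) k)"
  let ?y = "\<lambda>k. vec d (\<lambda>i. ppm_center (entry H) (y i) (\<lambda>l. g l i) k)"
  let ?g = "\<lambda>k. vec d (g k)"
  let ?B = "insert (0\<^sub>v d, 0\<^sub>v d) ((\<lambda>k. (?x k, ?g k)) ` {1..N})"
  have p: "0 \<le> (?g k - ?g j) \<bullet> (?x k - ?x j)" if "k \<in> {1..N}" "j \<in> {1..N}" for k j
  proof -
    have *: "0 \<le> (?g k - ?g j) \<bullet> (?x k - ?x j)" if "k \<in> {1..N}" "j \<in> {1..<k}" for k j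
      using data that unfolding ppm_data_def by (auto simp: scalar_prod_def atLeast0LessThan)
    have "(?g k - ?g j) \<bullet> (?x k - ?x j) = (?g j - ?g k) \<bullet> (?x j - ?x k)"
      by (auto simp: scalar_prod_def algebra_simps)
    moreover have "(?g k - ?g k) \<bullet> (?x k - ?x k) = 0"
      by (simp add: scalar_prod_def)
    moreover have "j \<in> {1..<k} \<or> k \<in> {1..<j} \<or> j = k" using that by auto
    ultimately show ?thesis using *[of k j] *[of j k] that by auto
  qed
  have z: "0 \<le> (?g k - 0\<^sub>v d) \<bullet> (?x k - 0\<^sub>v d)" "0 \<le> (0\<^sub>v d - ?g k) \<bullet> (0\<^sub>v d - ?x k)" if "k \<in> {1..N}" for k
    using data that unfolding ppm_data_def by (auto simp: scalar_prod_def atLeast0LessThan)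
  have "monotone_operator d ?B"
    unfolding monotone_operator_def using p z by (auto simp: scalar_prod_def)
  then obtain A where A: "?B \<subseteq> A" "maximally_monotone d A"
    using ex_maximally_monotone_extension by blast
  then have mono: "monotone_operator d A" by (simp add: maximally_monotone_def)
  have "ppm_iterates N H d A ?x ?g ?y"
    unfolding ppm_iterates_def
  proof (intro conjI allI impI)
    fix k assume k: "k < N"
    have y: "?y k = ?x (k + 1) + ?g (k + 1)"
      by (intro eq_vecI) (auto simp: ppm_point_def)
    have "(?x (k + 1), ?g (k + 1)) \<in> A" using A(1) k by auto
    then show "resolvent A `` {?y k} = {?x (k + 1)}"
      unfolding y by (rule resolvent_image_eq[OF mono])
    show "?g (k + 1) = ?y k - ?x (k + 1)"
      by (intro eq_vecI) (auto simp: ppm_point_def)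
  next
    fix k assume k: "k < N - 1"
    let ?s = "\<lambda>j. (2 * entry H (k + 1) (j + 1)) \<cdot>\<^sub>v ?g (j + 1)"
    have s: "?s \<in> {0..k} \<rightarrow> carrier_vec d" by auto
    show "?y (k + 1) = ?y k - finsum_vec TYPE(real) d ?s {0..k}"
    proof (rule eq_vecI)
      fix i assume "i < dim_vec (?y k - finsum_vec TYPE(real) d ?s {0..k})"
      then have i: "i < d" using finsum_vec_closed[OF s] by auto
      have "(\<Sum>l = 1..Suc k. 2 * entry H (Suc k) l * g l i) = (\<Sum>j = 0..k. 2 * entry H (Suc k) (Suc j) * g (Suc j) i)"
        unfolding One_nat_def sum.shift_bounds_cl_Suc_ivl ..
      then show "?y (k + 1) $ i = (?y k - finsum_vec TYPE(real) d ?s {0..k}) $ i"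
        using i s finsum_vec_closed[OF s]
        by (simp add: index_finsum_vec ppm_center_def sum_distrib_left algebra_simps)
    qed (use finsum_vec_closed[OF s] in auto)
  qed simp
  moreover have "(0\<^sub>v d, 0\<^sub>v d) \<in> A" using A(1) by auto
  ultimately have "sq_norm_v (?g N) \<le> sq_norm_v (?y 0 - 0\<^sub>v d) / (real N)\<^sup>2"
    using rate[unfolded achieves_optimal_rate_def, rule_format, OF d, of A "0\<^sub>v d" ?x ?g ?y] A(2) by simp
  moreover have "sq_norm_v (?g N) = (\<Sum>i<d. (g N i)\<^sup>2)"
    by (simp add: sq_norm_v_def scalar_prod_def atLeast0LessThan power2_eq_square)
  moreover have "sq_norm_v (?y 0 - 0\<^sub>v d) = (\<Sum>i<d. (y i)\<^sup>2)"
    by (simp add: sq_norm_v_def scalar_prod_def atLeast0LessThan ppm_center_def power2_eq_square)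
  ultimately show ?thesis
    using N by (simp add: field_simps)
qed

section \<open>Sufficiency\<close>

context certificate_polys
begin

definition multiplier :: "nat \<Rightarrow> nat \<Rightarrow> real" where
  "multiplier k j = - real N * cert_form N (q k) (q j)"

text \<open>Since \<open>|y|^2 - N^2 |g|^2 = |y - N g|^2 + 2 N <g, y - N g>\<close> for
  \<open>g = g N\<close>, it remains to split \<open>y - N g\<close> into \<open>x N\<close> and
  \<open>y - x N - N g\<close>, and to sum the certificate identity over the coordinates.\<close>

lemma energy_identity:
  fixes y :: "nat \<Rightarrow> real" and g :: "nat \<Rightarrow> nat \<Rightarrow> real"
  assumes inv: "(\<Sum>k = 1..N. q k) = invariant_poly N"
  defines "x \<equiv> \<lambda>k i. ppm_point h (y i) (\<lambda>l. g l i) k"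
  shows "(\<Sum>i<d. (y i)\<^sup>2) - (real N)\<^sup>2 * (\<Sum>i<d. (g N i)\<^sup>2) =
    (\<Sum>i<d. (y i - real N * g N i)\<^sup>2) + 2 * real N * (\<Sum>i<d. g N i * x N i) +
    2 * real N * (\<Sum>k = 1..N. \<Sum>j = 1..k - 1. multiplier k j * (\<Sum>i<d. (g k i - g j i) * (x k i - x j i)))"
proof -
  have "(\<Sum>k = 1..N. \<Sum>j = 1..k - 1. multiplier k j * (\<Sum>i<d. (g k i - g j i) * (x k i - x j i)))
      = (\<Sum>i<d. \<Sum>k = 1..N. \<Sum>j = 1..k - 1. multiplier k j * ((g k i - g j i) * (x k i - x j i)))"
    by (simp only: sum_distrib_left sum.swap[where B = "{..<d}"])
  also have "\<dots> = (\<Sum>i<d. g N i * (y i - x N i - real N * g N i))"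
    unfolding multiplier_def x_def by (intro sum.cong refl certificate_sum inv)
  finally show ?thesis
    by (simp add: sum_distrib_left sum.distrib [symmetric] sum_subtractf [symmetric]
        power2_eq_square algebra_simps)
qed

lemma rate_of_ppm_data:
  assumes inv: "(\<Sum>k = 1..N. q k) = invariant_poly N"
    and nonneg: "\<And>k j. k \<in> {2..N} \<Longrightarrow> j \<in> {1..k - 1} \<Longrightarrow> 0 \<le> multiplier k j"
    and data: "ppm_data N h d y g"
  shows "(real N)\<^sup>2 * (\<Sum>i<d. (g N i)\<^sup>2) \<le> (\<Sum>i<d. (y i)\<^sup>2)"
proof -
  let ?x = "\<lambda>k i. ppm_point h (y i) (\<lambda>l. g l i) k"
  have "0 \<le> (\<Sum>i<d. g N i * ?x N i)"
    using data N_pos unfolding ppm_data_def by auto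
  moreover have "0 \<le> (\<Sum>k = 1..N. \<Sum>j = 1..k - 1. multiplier k j * (\<Sum>i<d. (g k i - g j i) * (?x k i - ?x j i)))"
  proof (intro sum_nonneg)
    fix k j assume kj: "k \<in> {1..N}" "j \<in> {1..k - 1}"
    then have "0 \<le> (\<Sum>i<d. (g k i - g j i) * (?x k i - ?x j i))"
      using data unfolding ppm_data_def by auto
    moreover have "0 \<le> multiplier k j" using kj by (intro nonneg) auto
    ultimately show "0 \<le> multiplier k j * (\<Sum>i<d. (g k i - g j i) * (?x k i - ?x j i))"
      by (rule mult_nonneg_nonneg[rotated])
  qed
  moreover have "0 \<le> (\<Sum>i<d. (y i - real N * g N i)\<^sup>2)"
    by (intro sum_nonneg) auto
  ultimately show ?thesis
    using energy_identity[OF inv, of y d g] N_pos by (smt (verit, best) mult_nonneg_nonneg of_nat_0_le_iff)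
qed

end

section \<open>The skew instance\<close>

text \<open>The coefficients are twice the gradients of the algorithm on the skew-symmetric operator whose
  inverse sends \<open>u\<close> to \<open>(\<Sum>l<i. u l) - (\<Sum>l>i. u l)\<close>, started at \<open>(1/2, \<dots>, 1/2)\<close>; its reflected
  resolvent is the negacyclic shift.\<close>

fun gradient_poly :: "(nat \<Rightarrow> nat \<Rightarrow> real) \<Rightarrow> nat \<Rightarrow> real poly" where
  "gradient_poly h 0 = 0"
| "gradient_poly h (Suc k) = (if k = 0 then 1 else
     gradient_poly h k + [:-1, 1:] * (\<Sum>j = 1..k. smult (h k j) (gradient_poly h j)))"

declare gradient_poly.simps(2) [simp del]

lemma gradient_poly_1: "gradient_poly h (Suc 0) = 1"
  by (simp add: gradient_poly.simps)

lemma gradient_poly_Suc: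
  "1 \<le> k \<Longrightarrow> gradient_poly h (Suc k) =
     gradient_poly h k + [:-1, 1:] * (\<Sum>j = 1..k. smult (h k j) (gradient_poly h j))"
  by (simp add: gradient_poly.simps)

lemma coeff_times_shift:
  "coeff ([:-1, 1:] * p) m = (if m = 0 then 0 else coeff p (m - 1)) - coeff (p :: real poly) m"
  by (cases m) (auto simp: coeff_pCons)

lemma coeff_gradient_poly_eq_0: "k \<le> m \<Longrightarrow> coeff (gradient_poly h k) m = 0"
proof (induction k arbitrary: m rule: less_induct)
  case (less k)
  show ?case
  proof (cases "k \<le> 1")
    case True
    then show ?thesis using less.prems by (cases k) (auto simp: gradient_poly_1)
  next
    case False
    then obtain l where k: "k = Suc l" "1 \<le> l" by (cases k) auto
    then show ?thesis
      using less
      by (auto simp: gradient_poly_Suc coeff_times_shift coeff_sum simp del: mult_pCons_left intro!: sum.neutral)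
  qed
qed

lemma coeff_gradient_poly_top:
  assumes "1 \<le> k"
  shows "coeff (gradient_poly h (Suc k)) k = h k k * coeff (gradient_poly h k) (k - 1)"
proof -
  have "(\<Sum>j = 1..k. h k j * coeff (gradient_poly h j) (k - 1)) =
      (\<Sum>j = 1..k. if j = k then h k k * coeff (gradient_poly h k) (k - 1) else 0)"
    by (intro sum.cong) (auto simp: coeff_gradient_poly_eq_0)
  also have "\<dots> = h k k * coeff (gradient_poly h k) (k - 1)"
    using assms by (subst sum.delta) auto
  finally show ?thesis
    using assms
    by (simp add: gradient_poly_Suc coeff_times_shift coeff_sum coeff_gradient_poly_eq_0 del: mult_pCons_left)
qed

text \<open>The top coefficients are successive products of diagonal entries of \<open>h\<close>, so
  a nonzero last one forces all earlier ones to be nonzero.\<close>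

lemma coeff_gradient_poly_top_nonzero:
  assumes "coeff (gradient_poly h N) (N - 1) \<noteq> 0" "1 \<le> k" "k \<le> N"
  shows "coeff (gradient_poly h k) (k - 1) \<noteq> 0"
  using assms(3,1,2)
proof (induction k rule: inc_induct)
  case (step k)
  then show ?case using coeff_gradient_poly_top[of k h] by auto
qed

text \<open>Every update carries the factor \<open>t - 1\<close>, so the value at 1 never
  changes.\<close>

lemma sum_coeff_gradient_poly:
  assumes "1 \<le> k" "k \<le> N"
  shows "(\<Sum>i<N. coeff (gradient_poly h k) i) = 1"
proof -
  have "poly (gradient_poly h k) 1 = 1"
    using assms(1)
  proof (induction k rule: nat_induct_at_least)
    case (Suc k)
    then show ?case by (simp add: gradient_poly_Suc del: mult_pCons_left)
  qed (simp add: gradient_poly_1)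
  moreover have "degree (gradient_poly h k) \<le> N - 1"
    using assms by (intro degree_le) (auto simp: coeff_gradient_poly_eq_0)
  then have "(\<Sum>i\<le>N - 1. monom (coeff (gradient_poly h k) i) i) = gradient_poly h k"
    by (rule poly_as_sum_of_monoms')
  then have "(\<Sum>i\<le>N - 1. coeff (gradient_poly h k) i) = poly (gradient_poly h k) 1"
    by (metis (no_types, lifting) monom_eq_1_iff mult.right_neutral poly_monom poly_sum power_one sum.cong)
  moreover have "{..N - 1} = {..<N}" using assms by auto
  ultimately show ?thesis by simp
qed

text \<open>Multiplication by \<open>t - 1\<close> telescopes under partial summation, so the
  partial sums of the coefficients follow the recursion of the algorithm.\<close>

lemma ppm_center_gradient_poly:
  assumes "k < N" "i < N"
  shows "ppm_center h (1 / 2) (\<lambda>l. coeff (gradient_poly h l) i / 2) k =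
    (\<Sum>l\<le>i. coeff (gradient_poly h (Suc k)) l) - 1 / 2"
  using assms(1)
proof (induction k)
  case 0
  have "(\<Sum>l\<le>i. coeff 1 l) = (\<Sum>l\<le>i. if l = 0 then 1 else 0 :: real)"
    by (intro sum.cong) auto
  then show ?case by (simp add: ppm_center_def gradient_poly_1)
next
  case (Suc k)
  define p where "p = (\<Sum>j = 1..Suc k. smult (h (Suc k) j) (gradient_poly h j))"
  have tele: "(\<Sum>l\<le>i. coeff ([:-1, 1:] * p) l) = - coeff p i"
    by (induction i) (auto simp: coeff_times_shift simp del: mult_pCons_left)
  have "ppm_center h (1 / 2) (\<lambda>l. coeff (gradient_poly h l) i / 2) (Suc k) =
      ppm_center h (1 / 2) (\<lambda>l. coeff (gradient_poly h l) i / 2) k - coeff p i"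
    by (simp add: ppm_center_def p_def coeff_sum sum_distrib_left)
  also have "\<dots> = (\<Sum>l\<le>i. coeff (gradient_poly h (Suc k)) l) - 1 / 2 + (\<Sum>l\<le>i. coeff ([:-1, 1:] * p) l)"
    using Suc by (simp add: tele del: mult_pCons_left)
  also have "\<dots> = (\<Sum>l\<le>i. coeff (gradient_poly h (Suc (Suc k))) l) - 1 / 2"
    by (simp add: gradient_poly_Suc[of "Suc k"] p_def sum.distrib del: mult_pCons_left)
  finally show ?case .
qed

definition skew_gradient :: "(nat \<Rightarrow> nat \<Rightarrow> real) \<Rightarrow> nat \<Rightarrow> nat \<Rightarrow> real" where
  "skew_gradient h k i = coeff (gradient_poly h k) i / 2"

lemma ppm_point_skew_gradient:
  assumes "1 \<le> k" "k \<le> N" "i < N"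
  shows "ppm_point h (1 / 2) (\<lambda>l. skew_gradient h l i) k =
    (\<Sum>l\<le>i. coeff (gradient_poly h k) l) - 1 / 2 - coeff (gradient_poly h k) i / 2"
  using assms ppm_center_gradient_poly[of "k - 1" N i h]
  by (simp add: ppm_point_def skew_gradient_def)

text \<open>Each product of distinct entries occurs once and each square with weight 1/2. Hence the
  pairing sees only the total of \<open>u\<close>.\<close>

lemma sum_mult_partial_sums:
  fixes u :: "nat \<Rightarrow> real"
  shows "(\<Sum>i<n. u i * ((\<Sum>l\<le>i. u l) - u i / 2)) = (\<Sum>i<n. u i)\<^sup>2 / 2"
  by (induction n) (simp_all add: lessThan_Suc_atMost[symmetric] power2_eq_square field_simps)

text \<open>Both coefficient vectors sum to 1, so their difference has total zero and its pairing
  with its own partial sums vanishes.\<close>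

lemma skew_gradient_pair:
  fixes N h
  defines "x \<equiv> \<lambda>k i. ppm_point h (1 / 2) (\<lambda>l. skew_gradient h l i) k"
  assumes k: "k \<in> {1..N}" and j: "j \<in> {1..N}"
  shows "(\<Sum>i<N. (skew_gradient h k i - skew_gradient h j i) * (x k i - x j i)) = 0"
proof -
  define u where "u i = coeff (gradient_poly h k) i - coeff (gradient_poly h j) i" for i
  have "(\<Sum>i<N. (skew_gradient h k i - skew_gradient h j i) * (x k i - x j i)) =
      (\<Sum>i<N. u i * ((\<Sum>l\<le>i. u l) - u i / 2) / 2)"
  proof (rule sum.cong)
    fix i assume "i \<in> {..<N}"
    then have x: "x l i = (\<Sum>m\<le>i. coeff (gradient_poly h l) m) - 1 / 2 - coeff (gradient_poly h l) i / 2"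
      if "l \<in> {1..N}" for l
      using that unfolding x_def by (intro ppm_point_skew_gradient) auto
    show "(skew_gradient h k i - skew_gradient h j i) * (x k i - x j i) = u i * ((\<Sum>l\<le>i. u l) - u i / 2) / 2"
      unfolding x[OF k] x[OF j] skew_gradient_def u_def sum_subtractf by (simp add: field_simps)
  qed simp
  also have "\<dots> = (\<Sum>i<N. u i)\<^sup>2 / 4"
    by (simp add: sum_divide_distrib [symmetric] sum_mult_partial_sums)
  also have "(\<Sum>i<N. u i) = 0"
    using k j by (simp add: u_def sum_subtractf sum_coeff_gradient_poly)
  finally show ?thesis by simp
qed

lemma skew_gradient_point:
  assumes k: "k \<in> {1..N}"
  shows "(\<Sum>i<N. skew_gradient h k i * ppm_point h (1 / 2) (\<lambda>l. skew_gradient h l i) k) = 0"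
proof -
  define u where "u = coeff (gradient_poly h k)"
  have "(\<Sum>i<N. skew_gradient h k i * ppm_point h (1 / 2) (\<lambda>l. skew_gradient h l i) k) =
      (\<Sum>i<N. u i * ((\<Sum>l\<le>i. u l) - u i / 2) / 2 - u i / 4)"
  proof (rule sum.cong)
    fix i assume "i \<in> {..<N}"
    then have x: "ppm_point h (1 / 2) (\<lambda>l. skew_gradient h l i) k = (\<Sum>m\<le>i. u m) - 1 / 2 - u i / 2"
      using k unfolding u_def by (intro ppm_point_skew_gradient) auto
    show "skew_gradient h k i * ppm_point h (1 / 2) (\<lambda>l. skew_gradient h l i) k =
        u i * ((\<Sum>l\<le>i. u l) - u i / 2) / 2 - u i / 4"
      unfolding x unfolding skew_gradient_def u_def by (simp add: field_simps)
  qed simp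
  also have "\<dots> = (\<Sum>i<N. u i)\<^sup>2 / 4 - (\<Sum>i<N. u i) / 4"
    by (simp add: sum_subtractf sum_divide_distrib [symmetric] sum_mult_partial_sums)
  also have "(\<Sum>i<N. u i) = 1"
    using k by (simp add: u_def sum_coeff_gradient_poly)
  finally show ?thesis by simp
qed

lemma ppm_data_skew_gradient: "ppm_data N h N (\<lambda>_. 1 / 2) (skew_gradient h)"
  unfolding ppm_data_def using skew_gradient_pair skew_gradient_point by auto

lemma coeff_gradient_poly_of_rate:
  assumes N: "0 < N"
    and rate: "(real N)\<^sup>2 * (\<Sum>i<N. (skew_gradient h N i)\<^sup>2) \<le> (\<Sum>i<N. (1 / 2)\<^sup>2)"
    and i: "i < N"
  shows "coeff (gradient_poly h N) i = 1 / real N"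
proof -
  define u where "u = coeff (gradient_poly h N)"
  have "(\<Sum>i<N. (skew_gradient h N i)\<^sup>2) = (\<Sum>i<N. (u i)\<^sup>2) / 4"
    by (simp add: skew_gradient_def u_def power_divide sum_divide_distrib)
  from rate[unfolded this] have "(real N)\<^sup>2 * (\<Sum>i<N. (u i)\<^sup>2) \<le> real N"
    by (simp add: power_divide)
  then have "(\<Sum>i<N. (u i)\<^sup>2) \<le> 1 / real N"
    using N by (simp add: field_simps power2_eq_square)
  moreover have "(\<Sum>i<N. u i) = 1"
    using N by (simp add: u_def sum_coeff_gradient_poly)
  \<comment> \<open>Equality case of Cauchy--Schwarz: the squared distance to the constant vector is
    at most \<open>1/N - 2/N + 1/N = 0\<close>.\<close>
  moreover have "(\<Sum>i<N. (u i - 1 / real N)\<^sup>2) =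
      (\<Sum>i<N. (u i)\<^sup>2) - 2 / real N * (\<Sum>i<N. u i) + (\<Sum>i<N. (1 / real N)\<^sup>2)"
    by (simp add: power2_diff sum.distrib sum_subtractf sum_distrib_left sum_divide_distrib algebra_simps)
  moreover have "(\<Sum>i<N. (1 / real N)\<^sup>2) = 1 / real N"
    using N by (simp add: power2_eq_square)
  ultimately have "(\<Sum>i<N. (u i - 1 / real N)\<^sup>2) \<le> 0" by simp
  then have "(\<Sum>i<N. (u i - 1 / real N)\<^sup>2) = 0"
    by (intro antisym sum_nonneg) auto
  then show ?thesis
    using i by (subst (asm) sum_nonneg_eq_0_iff) (auto simp: u_def)
qed

section \<open>From the flat last gradient to the invariants\<close>

lemma coeff_one_plus_power: "coeff ([:1, 1:] ^ n :: real poly) m = real (n choose m)"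
proof (cases "m \<le> n")
  case False
  then show ?thesis by (simp add: coeff_eq_0 degree_linear_power)
qed (simp add: coeff_linear_poly_power)

text \<open>Substituting \<open>1 + t\<close> into the geometric sum
  \<open>(1 + s + ... + s^(N - 1)) / N\<close>; on coefficients this is the hockey-stick
  identity.\<close>

lemma invariant_poly_eq_pcompose:
  assumes "0 < N"
  shows "invariant_poly N = pcompose (\<Sum>i<N. monom (1 / real N) i) [:1, 1:]"
proof (rule poly_eqI)
  have monom: "pcompose (monom c i) [:1, 1:] = smult c ([:1, 1:] ^ i)" for c :: real and i
    by (induction i) (simp_all add: monom_0 monom_Suc pcompose_pCons)
  fix m
  have "coeff (pcompose (\<Sum>i<N. monom (1 / real N) i) [:1, 1:]) m = (\<Sum>i<N. 1 / real N * real (i choose m))"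
    by (simp add: pcompose_sum monom coeff_sum coeff_one_plus_power)
  also have "\<dots> = real (\<Sum>i\<le>N - 1. i choose m) / real N"
    using assms by (simp add: sum_divide_distrib lessThan_Suc_atMost [symmetric])
  also have "(\<Sum>i\<le>N - 1. i choose m) = N choose Suc m"
    using assms by (simp only: sum_choose_upper) simp
  finally show "coeff (invariant_poly N) m = coeff (pcompose (\<Sum>i<N. monom (1 / real N) i) [:1, 1:]) m"
    by (simp add: coeff_invariant_poly)
qed

context certificate_polys
begin

text \<open>The gradients are generated forwards along the rows of \<open>h\<close>, the polynomials
  \<open>q\<close> backwards along its columns. Both expand into the same chains, with
  \<open>t - 1\<close> in place of \<open>t\<close>.\<close>

lemma gradient_poly_eq_sum_q:
  "gradient_poly h N = pcompose (\<Sum>k = 1..N. q k) [:-1, 1:]"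
proof -
  define W where "W s = pcompose (\<Sum>j \<in> {s<..N}. q j) [:-1, 1:]" for s
  define v where "v = gradient_poly h"
  have q: "pcompose (q k) [:-1, 1:] = [:-1, 1:] * (\<Sum>a \<in> {k..<N}. smult (h a k) (W a))"
    if "k \<in> {1..<N}" for k
  proof -
    have "pcompose (q k) [:-1, 1:] =
      pcompose (pCons 0 (\<Sum>a \<in> {k..<N}. smult (h a k) (\<Sum>j \<in> {a<..N}. q j))) [:-1, 1:]"
      by (subst q_rec[OF that]) (rule refl)
    then show ?thesis
      by (simp add: pcompose_pCons pcompose_sum pcompose_smult W_def)
  qed
  have W: "W s = W (Suc s) + pcompose (q (Suc s)) [:-1, 1:]" if "s < N" for s
  proof -
    have "{s<..N} = insert (Suc s) {Suc s<..N}" using that by auto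
    then show ?thesis by (simp add: W_def pcompose_add)
  qed
  \<comment> \<open>Unrolls the last gradient backwards: all \<open>v l\<close> with
    \<open>l > Suc s\<close> are eliminated, and \<open>W s\<close> is the weight accumulated on
    \<open>v (Suc s)\<close>. The invariant is trivial at \<open>s = N - 1\<close> and yields
    \<open>v N = W 0\<close> at \<open>s = 0\<close>.\<close>
  have inv: "v N = W s * v (Suc s) +
      [:-1, 1:] * (\<Sum>l = 1..s. (\<Sum>a \<in> {Suc s..<N}. smult (h a l) (W a)) * v l)" if "s \<le> N - 1" for s
    using that
  proof (induction s rule: inc_induct)
    case base
    have "{N - 1<..N} = {N}" using N_pos by auto
    then have "W (N - 1) = 1" by (simp add: W_def q_N pcompose_1)
    then show ?case using N_pos by simp
  next
    case (step s)
    then have s: "Suc s \<in> {1..<N}" by auto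
    let ?X = "[:-1, 1:] :: real poly"
    let ?f = "\<lambda>l. (\<Sum>a \<in> {Suc (Suc s)..<N}. smult (h a l) (W a))"
    have ivl: "{Suc s..<N} = insert (Suc s) {Suc (Suc s)..<N}" using s by auto
    have f: "(\<Sum>a \<in> {Suc s..<N}. smult (h a l) (W a)) = smult (h (Suc s) l) (W (Suc s)) + ?f l" for l
      unfolding ivl by simp
    have v: "v (Suc (Suc s)) = v (Suc s) + ?X * (\<Sum>l = 1..Suc s. smult (h (Suc s) l) (v l))"
      unfolding v_def by (rule gradient_poly_Suc) simp
    have "v N = W (Suc s) * v (Suc (Suc s)) + ?X * (\<Sum>l = 1..Suc s. ?f l * v l)"
      by (rule step)
    also have "\<dots> = W (Suc s) * v (Suc s) +
        ?X * (\<Sum>l = 1..Suc s. (smult (h (Suc s) l) (W (Suc s)) + ?f l) * v l)"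
      unfolding v by (simp add: sum.distrib sum_distrib_left algebra_simps del: mult_pCons_left mult_pCons_right)
    also have "\<dots> = (W (Suc s) + ?X * (\<Sum>a \<in> {Suc s..<N}. smult (h a (Suc s)) (W a))) * v (Suc s) +
        ?X * (\<Sum>l = 1..s. (\<Sum>a \<in> {Suc s..<N}. smult (h a l) (W a)) * v l)"
      unfolding f by (simp add: algebra_simps del: mult_pCons_left mult_pCons_right)
    also have "W (Suc s) + ?X * (\<Sum>a \<in> {Suc s..<N}. smult (h a (Suc s)) (W a)) = W s"
      using W[of s] q[OF s] s by simp
    finally show ?case .
  qed
  have "v N = W 0" using inv[of 0] by (simp add: v_def gradient_poly_1)
  moreover have "{0<..N} = {1..N}" by auto
  ultimately show ?thesis by (simp add: v_def W_def)
qed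

lemma sum_q_eq_invariant_poly:
  assumes "\<And>i. i < N \<Longrightarrow> coeff (gradient_poly h N) i = 1 / real N"
  shows "(\<Sum>k = 1..N. q k) = invariant_poly N"
proof -
  have "gradient_poly h N = (\<Sum>i<N. monom (1 / real N) i)"
    by (rule poly_eqI) (auto simp: coeff_sum assms coeff_gradient_poly_eq_0 not_less)
  then have "invariant_poly N = pcompose (pcompose (\<Sum>k = 1..N. q k) [:-1, 1:]) [:1, 1:]"
    by (simp only: invariant_poly_eq_pcompose[OF N_pos] gradient_poly_eq_sum_q)
  also have "\<dots> = (\<Sum>k = 1..N. q k)"
    by (simp add: pcompose_assoc [symmetric] pcompose_pCons pcompose_idR)
  finally show ?thesis ..
qed

end

section \<open>Perturbing the skew instance\<close>

lemma ppm_center_cong: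
  assumes "\<And>l. l \<in> {1..k} \<Longrightarrow> g l = g' l"
  shows "ppm_center h y g k = ppm_center h y g' k"
  unfolding ppm_center_def using assms by (auto intro!: sum.cong)

lemma ppm_point_perturb:
  "ppm_point h y (\<lambda>l. g l + e * g' l) k = ppm_point h y g k + e * ppm_point h 0 g' k"
proof -
  have "(\<Sum>a = 1..k - 1. \<Sum>l = 1..a. h a l * (g l + e * g' l)) =
      (\<Sum>a = 1..k - 1. \<Sum>l = 1..a. h a l * g l) + e * (\<Sum>a = 1..k - 1. \<Sum>l = 1..a. h a l * g' l)"
    by (simp add: sum_distrib_left sum.distrib algebra_simps)
  then show ?thesis
    unfolding ppm_point_def ppm_center_def by (simp add: algebra_simps)
qed

text \<open>Changing the coordinate \<open>w K\<close> adjusts equation \<open>Suc K\<close> and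
  leaves the earlier ones intact, because \<open>c k K = 0\<close> for
  \<open>k \<le> K\<close>.\<close>

lemma solve_triangular:
  fixes c :: "nat \<Rightarrow> nat \<Rightarrow> real"
  assumes zero: "\<And>k i. k \<le> i \<Longrightarrow> c k i = 0"
    and top: "\<And>k. k \<in> {1..N} \<Longrightarrow> c k (k - 1) \<noteq> 0"
    and "K \<le> N"
  shows "\<exists>w. \<forall>k \<in> {1..K}. (\<Sum>i<N. w i * c k i) = b k"
  using assms(3)
proof (induction K)
  case (Suc K)
  then have "\<exists>w. \<forall>k \<in> {1..K}. (\<Sum>i<N. w i * c k i) = b k" by simp
  then obtain w where w: "\<And>k. k \<in> {1..K} \<Longrightarrow> (\<Sum>i<N. w i * c k i) = b k" by blast
  define w' where "w' = w(K := w K + (b (Suc K) - (\<Sum>i<N. w i * c (Suc K) i)) / c (Suc K) K)"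
  have upd: "(\<Sum>i<N. w' i * c k i) = (\<Sum>i<N. w i * c k i) + (w' K - w K) * c k K" for k
  proof -
    have "(\<Sum>i<N. w' i * c k i) = (\<Sum>i<N. w i * c k i + (if i = K then (w' K - w K) * c k K else 0))"
      by (intro sum.cong) (auto simp: w'_def algebra_simps)
    also have "\<dots> = (\<Sum>i<N. w i * c k i) + (w' K - w K) * c k K"
      using Suc.prems by (simp add: sum.distrib)
    finally show ?thesis .
  qed
  have "(\<Sum>i<N. w' i * c k i) = b k" if "k \<in> {1..Suc K}" for k
  proof (cases "k = Suc K")
    case True
    have "c (Suc K) K \<noteq> 0" using top[of "Suc K"] Suc.prems by auto
    then show ?thesis unfolding upd True by (simp add: w'_def)
  next
    case False
    then show ?thesis using that w zero[of k K] unfolding upd by auto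
  qed
  then show ?case by blast
qed simp

text \<open>Transposes the map sending the gradient \<open>c\<close> to the point minus the gradient.\<close>

lemma sum_mult_centered_partial_sums:
  fixes c w :: "nat \<Rightarrow> real"
  assumes "0 < N"
  defines "w' \<equiv> \<lambda>i. if i = 0 then - w (N - 1) - w 0 else w (i - 1) - w i"
  shows "(\<Sum>i<N. w' i * ((\<Sum>l<i. c l) - (\<Sum>l<N. c l) / 2)) = (\<Sum>i<N. w i * c i)"
proof -
  define D where "D i = (\<Sum>l<i. c l) - (\<Sum>l<N. c l) / 2" for i
  have "(\<Sum>i = 1..<M. (w (i - 1) - w i) * D i) = (\<Sum>i<M. w i * c i) + w 0 * D 0 - w (M - 1) * D M"
    if "1 \<le> M" for M
    using that
  proof (induction M rule: nat_induct_at_least)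
    case base
    then show ?case by (simp add: D_def algebra_simps)
  next
    case (Suc M)
    have "D (Suc M) = D M + c M" by (simp add: D_def)
    then show ?case using Suc by (simp add: algebra_simps)
  qed
  moreover have "(\<Sum>i = 1..<N. w' i * D i) = (\<Sum>i = 1..<N. (w (i - 1) - w i) * D i)"
    by (intro sum.cong) (auto simp: w'_def)
  ultimately have "(\<Sum>i = 1..<N. w' i * D i) = (\<Sum>i<N. w i * c i) + w 0 * D 0 - w (N - 1) * D N"
    using assms(1) by simp
  moreover have "{..<N} = insert 0 {1..<N}" using assms(1) by auto
  ultimately have "(\<Sum>i<N. w' i * D i) = (\<Sum>i<N. w i * c i) + (w 0 + w' 0) * D 0 - w (N - 1) * D N"
    by (simp add: algebra_simps)
  \<comment> \<open>Since \<open>D N = - D 0\<close> and \<open>w 0 + w' 0 = - w (N - 1)\<close>,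
    the boundary terms cancel; this dictates the sign in the first entry of
    \<open>w'\<close>.\<close>
  then show ?thesis
    by (simp add: w'_def D_def algebra_simps)
qed

text \<open>The reflected vectors \<open>x k - g k\<close> are a fixed linear image of the
  coefficient vectors. Transposing that map leaves a triangular system, whose diagonal consists of
  the nonzero top coefficients.\<close>

lemma ex_direction:
  fixes N h
  defines "x \<equiv> \<lambda>k i. ppm_point h (1 / 2) (\<lambda>l. skew_gradient h l i) k"
  assumes top: "coeff (gradient_poly h N) (N - 1) \<noteq> 0"
  shows "\<exists>w. \<forall>k \<in> {1..N}. (\<Sum>i<N. w i * (x k i - skew_gradient h k i)) = b k"
proof -
  define c where "c k = coeff (gradient_poly h k)" for k
  have "\<exists>w. \<forall>k \<in> {1..N}. (\<Sum>i<N. w i * c k i) = b k"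
    by (rule solve_triangular)
      (auto simp: c_def coeff_gradient_poly_eq_0 coeff_gradient_poly_top_nonzero[OF top, simplified])
  then obtain w where w: "\<And>k. k \<in> {1..N} \<Longrightarrow> (\<Sum>i<N. w i * c k i) = b k"
    by blast
  define w' where "w' i = (if i = 0 then - w (N - 1) - w 0 else w (i - 1) - w i)" for i
  have "(\<Sum>i<N. w' i * (x k i - skew_gradient h k i)) = b k" if k: "k \<in> {1..N}" for k
  proof -
    have N: "0 < N" using k by auto
    have "x k i - skew_gradient h k i = (\<Sum>l<i. c k l) - (\<Sum>l<N. c k l) / 2" if "i < N" for i
    proof -
      have "x k i = (\<Sum>l\<le>i. c k l) - 1 / 2 - c k i / 2"
        unfolding x_def c_def by (rule ppm_point_skew_gradient) (use k that in auto)
      moreover have "(\<Sum>l<N. c k l) = 1"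
        using k by (simp add: c_def sum_coeff_gradient_poly)
      moreover have "skew_gradient h k i = c k i / 2" by (simp add: skew_gradient_def c_def)
      ultimately show ?thesis by (simp add: lessThan_Suc_atMost [symmetric])
    qed
    then have "(\<Sum>i<N. w' i * (x k i - skew_gradient h k i)) =
        (\<Sum>i<N. w' i * ((\<Sum>l<i. c k l) - (\<Sum>l<N. c k l) / 2))"
      by (intro sum.cong) auto
    also have "\<dots> = (\<Sum>i<N. w i * c k i)"
      unfolding w'_def by (rule sum_mult_centered_partial_sums[OF N])
    finally show ?thesis using w[OF k] by simp
  qed
  then show ?thesis by blast
qed

text \<open>Prescribes the first variation of every monotonicity product; the column \<open>j = 0\<close> stands for
  the pairing with the zero of the operator. The unknown \<open>g' k\<close> enters the conditions of row \<open>k\<close>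
  only through its products with \<open>x j - g j\<close>, \<open>j \<le> k\<close>.\<close>

lemma ex_first_variation:
  fixes g x :: "nat \<Rightarrow> nat \<Rightarrow> real" and \<delta> :: "nat \<Rightarrow> nat \<Rightarrow> real"
  assumes dir: "\<And>b. \<exists>w. \<forall>k \<in> {1..N}. (\<Sum>i<d. w i * (x k i - g k i)) = b k"
    and "K \<le> N"
  shows "\<exists>g'. \<forall>k \<in> {1..K}.
     (\<Sum>i<d. g' k i * x k i + g k i * ppm_point h 0 (\<lambda>l. g' l i) k) = \<delta> k 0 \<and>
     (\<forall>j \<in> {1..<k}. (\<Sum>i<d. (g' k i - g' j i) * (x k i - x j i) +
        (g k i - g j i) * (ppm_point h 0 (\<lambda>l. g' l i) k - ppm_point h 0 (\<lambda>l. g' l i) j)) = \<delta> k j)"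
  using assms(2)
proof (induction K)
  case (Suc K)
  then obtain g' where g': "\<forall>k \<in> {1..K}.
     (\<Sum>i<d. g' k i * x k i + g k i * ppm_point h 0 (\<lambda>l. g' l i) k) = \<delta> k 0 \<and>
     (\<forall>j \<in> {1..<k}. (\<Sum>i<d. (g' k i - g' j i) * (x k i - x j i) +
        (g k i - g j i) * (ppm_point h 0 (\<lambda>l. g' l i) k - ppm_point h 0 (\<lambda>l. g' l i) j)) = \<delta> k j)"
    by auto
  let ?k = "Suc K"
  define C where "C i = ppm_center h 0 (\<lambda>l. g' l i) K" for i
  define P where "P j i = ppm_point h 0 (\<lambda>l. g' l i) j" for j i
  define b0 where "b0 = \<delta> ?k 0 - (\<Sum>i<d. g ?k i * C i)"
  \<comment> \<open>The entry at \<open>?k\<close> is fixed by the pairing with the zero. Each pair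
    condition with \<open>j < ?k\<close> then fixes the entry at \<open>j\<close>, as everything
    else in it comes from earlier rows.\<close>
  define b where "b j = (if j = ?k then b0 else
      b0 - (\<delta> ?k j + (\<Sum>i<d. g' j i * (x ?k i - x j i) - (g ?k i - g j i) * (C i - P j i))))" for j
  obtain w where w: "\<And>j. j \<in> {1..N} \<Longrightarrow> (\<Sum>i<d. w i * (x j i - g j i)) = b j"
    using dir[of b] by blast
  define g'' where "g'' = g'(?k := w)"
  have P_old: "ppm_point h 0 (\<lambda>l. g'' l i) j = P j i" if "j \<in> {1..K}" for i j
    using that unfolding P_def ppm_point_def g''_def
    by (subst ppm_center_cong[of "j - 1" "\<lambda>l. (g'(?k := w)) l i" "\<lambda>l. g' l i"]) auto
  \<comment> \<open>The center of step \<open>?k\<close> uses only earlier gradients, so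
    \<open>w\<close> enters the new point solely through \<open>- w\<close>.\<close>
  have P_new: "ppm_point h 0 (\<lambda>l. g'' l i) ?k = C i - w i" for i
    unfolding C_def ppm_point_def g''_def
    by (subst ppm_center_cong[of _ "\<lambda>l. (g'(?k := w)) l i" "\<lambda>l. g' l i"]) auto
  have old: "g'' j = g' j" if "j \<in> {1..K}" for j using that by (auto simp: g''_def)
  have new: "g'' ?k = w" by (simp add: g''_def)
  have wk: "(\<Sum>i<d. w i * (x ?k i - g ?k i)) = b0"
    using w[of ?k] Suc.prems by (simp add: b_def)
  show ?case
  proof (rule exI[of _ g''], rule ballI)
    fix k assume k: "k \<in> {1..?k}"
    show "(\<Sum>i<d. g'' k i * x k i + g k i * ppm_point h 0 (\<lambda>l. g'' l i) k) = \<delta> k 0 \<and>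
     (\<forall>j \<in> {1..<k}. (\<Sum>i<d. (g'' k i - g'' j i) * (x k i - x j i) +
        (g k i - g j i) * (ppm_point h 0 (\<lambda>l. g'' l i) k - ppm_point h 0 (\<lambda>l. g'' l i) j)) = \<delta> k j)"
    proof (cases "k = ?k")
      case False
      then have k': "k \<in> {1..K}" using k by auto
      have j': "j \<in> {1..K}" if "j \<in> {1..<k}" for j using that k' by auto
      show ?thesis
        using g'[rule_format, OF k'] by (auto simp: P_old[OF k'] P_old[OF j'] old[OF k'] old[OF j'] P_def[symmetric])
    next
      case True
      have "(\<Sum>i<d. g'' ?k i * x ?k i + g ?k i * ppm_point h 0 (\<lambda>l. g'' l i) ?k) =
          (\<Sum>i<d. w i * (x ?k i - g ?k i)) + (\<Sum>i<d. g ?k i * C i)"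
        unfolding P_new new sum.distrib [symmetric] by (intro sum.cong) (auto simp: algebra_simps)
      then have 1: "(\<Sum>i<d. g'' ?k i * x ?k i + g ?k i * ppm_point h 0 (\<lambda>l. g'' l i) ?k) = \<delta> ?k 0"
        unfolding wk b0_def by simp
      have 2: "(\<Sum>i<d. (g'' ?k i - g'' j i) * (x ?k i - x j i) +
        (g ?k i - g j i) * (ppm_point h 0 (\<lambda>l. g'' l i) ?k - ppm_point h 0 (\<lambda>l. g'' l i) j)) = \<delta> ?k j"
        if j: "j \<in> {1..<?k}" for j
      proof -
        have j': "j \<in> {1..K}" using j by auto
        have "(\<Sum>i<d. (g'' ?k i - g'' j i) * (x ?k i - x j i) +
            (g ?k i - g j i) * (ppm_point h 0 (\<lambda>l. g'' l i) ?k - ppm_point h 0 (\<lambda>l. g'' l i) j)) =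
          (\<Sum>i<d. w i * (x ?k i - g ?k i)) - (\<Sum>i<d. w i * (x j i - g j i)) -
          (\<Sum>i<d. g' j i * (x ?k i - x j i) - (g ?k i - g j i) * (C i - P j i))"
          unfolding P_new P_old[OF j'] new old[OF j'] sum_subtractf [symmetric]
          by (intro sum.cong) (auto simp: algebra_simps)
        also have "\<dots> = \<delta> ?k j"
          using w[of j] j Suc.prems unfolding wk by (simp add: b_def)
        finally show ?thesis .
      qed
      show ?thesis using 1 2 unfolding True by blast
    qed
  qed
qed simp

lemma eventually_linear_dominates:
  fixes a b :: real
  assumes "0 < a"
  shows "eventually (\<lambda>e. 0 < e * a + e\<^sup>2 * b) (at_right 0)"
proof -
  have "0 < e * a + e\<^sup>2 * b" if e: "0 < e" "e < a / (\<bar>b\<bar> + 1)" for e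
  proof -
    have "e * (\<bar>b\<bar> + 1) < a" using e(2) by (simp add: pos_less_divide_eq)
    moreover have "e * (- b) \<le> e * (\<bar>b\<bar> + 1)" using e(1) by (intro mult_left_mono) auto
    ultimately have "0 < a + e * b" by linarith
    then have "0 < e * (a + e * b)" using e(1) by simp
    then show ?thesis by (simp add: power2_eq_square algebra_simps)
  qed
  moreover have "0 < a / (\<bar>b\<bar> + 1)" using assms by simp
  ultimately show ?thesis unfolding eventually_at_right_field by blast
qed

section \<open>Nonnegativity of the multipliers from the rate\<close>

context certificate_polys
begin

text \<open>At the skew instance every term of the energy identity vanishes. To first order the
  energy is therefore a weighted sum of the prescribed variations, and concentrating these on
  \<open>(k0, j0)\<close> exposes the sign of its multiplier.\<close>

lemma multiplier_nonneg_of_rate: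
  assumes inv: "(\<Sum>k = 1..N. q k) = invariant_poly N"
    and flat: "\<And>i. i < N \<Longrightarrow> coeff (gradient_poly h N) i = 1 / real N"
    and rate: "\<And>y g. ppm_data N h N y g \<Longrightarrow> (real N)\<^sup>2 * (\<Sum>i<N. (g N i)\<^sup>2) \<le> (\<Sum>i<N. (y i)\<^sup>2)"
    and k0: "k0 \<in> {2..N}" and j0: "j0 \<in> {1..k0 - 1}"
  shows "0 \<le> multiplier k0 j0"
proof (rule ccontr)
  assume "\<not> 0 \<le> multiplier k0 j0"
  then have neg: "multiplier k0 j0 < 0" by simp
  \<comment> \<open>With variation 1 at \<open>(k0, j0)\<close> and \<eta> elsewhere, including the
    pairing of \<open>x N\<close> with the zero, the first-order energy is
    \<open>2 * N * (multiplier k0 j0 + \<eta> * s)\<close>. The choice of \<eta> makes the bracket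
    at most half the negative multiplier.\<close>
  define S where "S = (\<Sum>k = 1..N. \<Sum>j = 1..k - 1. multiplier k j)"
  define s where "s = 1 + S - multiplier k0 j0"
  define \<eta> where "\<eta> = - multiplier k0 j0 / (2 * (\<bar>s\<bar> + 1))"
  have \<eta>: "0 < \<eta>" unfolding \<eta>_def by (rule divide_pos_pos) (use neg in auto)
  have slope: "multiplier k0 j0 + \<eta> * s < 0"
  proof -
    have "\<eta> * s \<le> \<eta> * (\<bar>s\<bar> + 1)" using \<eta> by (intro mult_left_mono) auto
    also have "\<dots> = - multiplier k0 j0 / 2" by (simp add: \<eta>_def field_simps)
    finally show ?thesis using neg by simp
  qed
  \<comment> \<open>All variations are strictly positive, so for small \<open>e\<close> they
    dominate the quadratic remainders and the perturbed data stay monotone.\<close>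
  define \<delta> where "\<delta> k j = (if k = k0 \<and> j = j0 then 1 else \<eta>)" for k j :: nat
  have \<delta>: "0 < \<delta> k j" for k j using \<eta> by (simp add: \<delta>_def)
  have sum_\<delta>: "(\<Sum>k = 1..N. \<Sum>j = 1..k - 1. multiplier k j * \<delta> k j) = \<eta> * S + (1 - \<eta>) * multiplier k0 j0"
  proof -
    have "(\<Sum>j = 1..k - 1. multiplier k j * \<delta> k j) =
        \<eta> * (\<Sum>j = 1..k - 1. multiplier k j) + (if k = k0 then (1 - \<eta>) * multiplier k0 j0 else 0)" for k
    proof -
      have "(\<Sum>j = 1..k - 1. multiplier k j * \<delta> k j) = (\<Sum>j = 1..k - 1. \<eta> * multiplier k j +
          (if j = j0 then if k = k0 then (1 - \<eta>) * multiplier k0 j0 else 0 else 0))"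
        by (intro sum.cong) (auto simp: \<delta>_def algebra_simps)
      then show ?thesis using j0 by (simp add: sum.distrib sum_distrib_left)
    qed
    then show ?thesis using k0 by (simp add: S_def sum.distrib sum_distrib_left)
  qed
  define g where "g = skew_gradient h"
  define x where "x k i = ppm_point h (1 / 2) (\<lambda>l. g l i) k" for k i
  have top: "coeff (gradient_poly h N) (N - 1) \<noteq> 0" using flat[of "N - 1"] N_pos by simp
  have dir: "\<exists>w. \<forall>k \<in> {1..N}. (\<Sum>i<N. w i * (x k i - g k i)) = b k" for b
    unfolding x_def g_def by (rule ex_direction[OF top])
  obtain g' where g': "\<And>k. k \<in> {1..N} \<Longrightarrow>
     (\<Sum>i<N. g' k i * x k i + g k i * ppm_point h 0 (\<lambda>l. g' l i) k) = \<delta> k 0 \<and>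
     (\<forall>j \<in> {1..<k}. (\<Sum>i<N. (g' k i - g' j i) * (x k i - x j i) +
        (g k i - g j i) * (ppm_point h 0 (\<lambda>l. g' l i) k - ppm_point h 0 (\<lambda>l. g' l i) j)) = \<delta> k j)"
    using ex_first_variation[where N = N and d = N and K = N and x = x and g = g and h = h and \<delta> = \<delta>] dir
    by blast
  define x' where "x' k i = ppm_point h 0 (\<lambda>l. g' l i) k" for k i
  define G where "G e k i = g k i + e * g' k i" for e k i
  have X: "ppm_point h (1 / 2) (\<lambda>l. G e l i) k = x k i + e * x' k i" for e k i
    unfolding G_def x_def x'_def by (rule ppm_point_perturb)
  define c where "c k j = (\<Sum>i<N. (g' k i - g' j i) * (x' k i - x' j i))" for k j
  define c0 where "c0 k = (\<Sum>i<N. g' k i * x' k i)" for k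
  have pair: "(\<Sum>i<N. (G e k i - G e j i) * ((x k i + e * x' k i) - (x j i + e * x' j i))) = e * \<delta> k j + e\<^sup>2 * c k j"
    if k: "k \<in> {1..N}" and j: "j \<in> {1..<k}" for e k j
  proof -
    have "(\<Sum>i<N. (G e k i - G e j i) * ((x k i + e * x' k i) - (x j i + e * x' j i))) =
       (\<Sum>i<N. (g k i - g j i) * (x k i - x j i)) +
       e * (\<Sum>i<N. (g' k i - g' j i) * (x k i - x j i) + (g k i - g j i) * (x' k i - x' j i)) + e\<^sup>2 * c k j"
      unfolding c_def sum_distrib_left sum.distrib [symmetric]
      by (intro sum.cong) (auto simp: G_def power2_eq_square algebra_simps)
    moreover have "(\<Sum>i<N. (g k i - g j i) * (x k i - x j i)) = 0"
      unfolding x_def g_def using k j by (intro skew_gradient_pair) auto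
    moreover have "(\<Sum>i<N. (g' k i - g' j i) * (x k i - x j i) + (g k i - g j i) * (x' k i - x' j i)) = \<delta> k j"
      using g'[OF k] j unfolding x'_def by blast
    ultimately show ?thesis by simp
  qed
  have point: "(\<Sum>i<N. G e k i * (x k i + e * x' k i)) = e * \<delta> k 0 + e\<^sup>2 * c0 k" if k: "k \<in> {1..N}" for e k
  proof -
    have "(\<Sum>i<N. G e k i * (x k i + e * x' k i)) =
       (\<Sum>i<N. g k i * x k i) + e * (\<Sum>i<N. g' k i * x k i + g k i * x' k i) + e\<^sup>2 * c0 k"
      unfolding c0_def sum_distrib_left sum.distrib [symmetric]
      by (intro sum.cong) (auto simp: G_def power2_eq_square algebra_simps)
    moreover have "(\<Sum>i<N. g k i * x k i) = 0"
      unfolding x_def g_def using k by (rule skew_gradient_point)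
    moreover have "(\<Sum>i<N. g' k i * x k i + g k i * x' k i) = \<delta> k 0"
      using g'[OF k] unfolding x'_def by blast
    ultimately show ?thesis by simp
  qed
  have "eventually (\<lambda>e. \<forall>k \<in> {1..N}. \<forall>j \<in> {1..<k}. 0 < e * \<delta> k j + e\<^sup>2 * c k j) (at_right 0)"
    by (intro eventually_ball_finite ballI eventually_linear_dominates \<delta>) auto
  moreover have "eventually (\<lambda>e. \<forall>k \<in> {1..N}. 0 < e * \<delta> k 0 + e\<^sup>2 * c0 k) (at_right 0)"
    by (intro eventually_ball_finite ballI eventually_linear_dominates \<delta>) auto
  ultimately have data: "eventually (\<lambda>e. ppm_data N h N (\<lambda>_. 1 / 2) (G e)) (at_right 0)"
    by eventually_elim (auto simp: ppm_data_def X pair point less_imp_le simp del: atLeastAtMost_iff atLeastLessThan_iff)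
  define c2 where "c2 = (real N)\<^sup>2 * (\<Sum>i<N. (g' N i)\<^sup>2) + 2 * real N * c0 N +
      2 * real N * (\<Sum>k = 1..N. \<Sum>j = 1..k - 1. multiplier k j * c k j)"
  define c1 where "c1 = - (2 * real N * (multiplier k0 j0 + \<eta> * s))"
  have energy: "(\<Sum>i<N. (1 / 2)\<^sup>2) - (real N)\<^sup>2 * (\<Sum>i<N. (G e N i)\<^sup>2) = - (e * c1 + e\<^sup>2 * (- c2))" for e
  proof -
    \<comment> \<open>Flatness makes \<open>y - N g N\<close> vanish at \<open>e = 0\<close>, so the
      square in the energy is of second order.\<close>
    have "1 / 2 - real N * G e N i = - (real N * e * g' N i)" if "i < N" for i
      using that N_pos by (simp add: G_def g_def skew_gradient_def flat algebra_simps)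
    then have "(\<Sum>i<N. (1 / 2 - real N * G e N i)\<^sup>2) = (\<Sum>i<N. (real N * e * g' N i)\<^sup>2)"
      by (intro sum.cong) (auto simp: power2_eq_square)
    then have 1: "(\<Sum>i<N. (1 / 2 - real N * G e N i)\<^sup>2) = e\<^sup>2 * ((real N)\<^sup>2 * (\<Sum>i<N. (g' N i)\<^sup>2))"
      by (simp add: power_mult_distrib sum_distrib_left mult_ac)
    have "(\<Sum>k = 1..N. \<Sum>j = 1..k - 1. multiplier k j *
        (\<Sum>i<N. (G e k i - G e j i) * ((x k i + e * x' k i) - (x j i + e * x' j i)))) =
      (\<Sum>k = 1..N. \<Sum>j = 1..k - 1. multiplier k j * (e * \<delta> k j + e\<^sup>2 * c k j))"
      by (intro sum.cong refl arg_cong2[of _ _ _ _ "(*)"] pair) auto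
    also have "\<dots> = e * (\<Sum>k = 1..N. \<Sum>j = 1..k - 1. multiplier k j * \<delta> k j) +
        e\<^sup>2 * (\<Sum>k = 1..N. \<Sum>j = 1..k - 1. multiplier k j * c k j)"
      by (simp add: sum_distrib_left sum.distrib algebra_simps)
    finally have 2: "(\<Sum>k = 1..N. \<Sum>j = 1..k - 1. multiplier k j *
        (\<Sum>i<N. (G e k i - G e j i) * ((x k i + e * x' k i) - (x j i + e * x' j i)))) =
        e * (\<eta> * S + (1 - \<eta>) * multiplier k0 j0) + e\<^sup>2 * (\<Sum>k = 1..N. \<Sum>j = 1..k - 1. multiplier k j * c k j)"
      unfolding sum_\<delta> .
    have "\<delta> N 0 = \<eta>" using j0 by (simp add: \<delta>_def)
    then have 3: "(\<Sum>i<N. G e N i * (x N i + e * x' N i)) = e * \<eta> + e\<^sup>2 * c0 N"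
      using point[of N e] N_pos by simp
    show ?thesis
      unfolding energy_identity[OF inv, of "\<lambda>_. 1 / 2" N "G e"] X 1 2 3 c1_def c2_def s_def
      by (simp add: algebra_simps)
  qed
  have "0 < c1"
    unfolding c1_def using slope N_pos by (simp add: mult_pos_neg)
  then have "eventually (\<lambda>e. 0 < e * c1 + e\<^sup>2 * (- c2)) (at_right 0)"
    by (rule eventually_linear_dominates)
  with data have "eventually (\<lambda>e. ppm_data N h N (\<lambda>_. 1 / 2) (G e) \<and> 0 < e * c1 + e\<^sup>2 * (- c2)) (at_right (0 :: real))"
    by eventually_elim simp
  then obtain e where e: "ppm_data N h N (\<lambda>_. 1 / 2) (G e)" "0 < e * c1 + e\<^sup>2 * (- c2)"
    using eventually_happens[of _ "at_right (0 :: real)"] by (auto simp: trivial_limit_at_right_real)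
  show False
    using rate[OF e(1)] energy[of e] e(2) by linarith
qed

end

theorem corollary1:
  fixes N :: nat and H :: "real mat"
  assumes "2 \<le> N"
    and "H \<in> carrier_mat (N - 1) (N - 1)"
    and "lower_triangular H"
  shows "achieves_optimal_rate N H \<longleftrightarrow>
    (\<forall>m \<in> {1..N - 1}. H_invariant (N - 1) m H = 1 / real N * real (N choose (m + 1))) \<and>
    (\<forall>k \<in> {2..N}. \<forall>j \<in> {1..k - 1}. 0 \<le> H_certificate N k j H)"
proof -
  have N: "0 < N" using assms(1) by simp
  interpret certificate_polys N "entry H" "Q_poly N H"
    by (rule certificate_polys_Q_poly[OF N])
  have cert: "H_certificate N k j H = multiplier k j" if "k \<in> {2..N}" "j \<in> {1..k - 1}" for k j
    unfolding multiplier_def using that by (intro H_certificate_eq_cert_form) auto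
  show ?thesis
    unfolding sum_Q_poly_eq_invariant_poly_iff[OF N, symmetric]
  proof (intro iffI conjI ballI; (elim conjE)?)
    assume rate: "achieves_optimal_rate N H"
    \<comment> \<open>Necessity is tested in dimension \<open>N\<close>, where the skew instance and
      its perturbations live.\<close>
    have bound: "(real N)\<^sup>2 * (\<Sum>i<N. (g N i)\<^sup>2) \<le> (\<Sum>i<N. (y i)\<^sup>2)"
      if "ppm_data N (entry H) N y g" for y g
      using N that by (intro achieves_optimal_rateD[OF rate]) auto
    have flat: "coeff (gradient_poly (entry H) N) i = 1 / real N" if "i < N" for i
      using that by (intro coeff_gradient_poly_of_rate bound ppm_data_skew_gradient N)
    show inv: "(\<Sum>k = 1..N. Q_poly N H k) = invariant_poly N"
      by (rule sum_q_eq_invariant_poly[OF flat])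
    show "0 \<le> H_certificate N k j H" if "k \<in> {2..N}" "j \<in> {1..k - 1}" for k j
      unfolding cert[OF that] using that by (intro multiplier_nonneg_of_rate inv flat bound)
  next
    assume "(\<Sum>k = 1..N. Q_poly N H k) = invariant_poly N"
      and "\<forall>k \<in> {2..N}. \<forall>j \<in> {1..k - 1}. 0 \<le> H_certificate N k j H"
    then show "achieves_optimal_rate N H"
      by (intro achieves_optimal_rateI rate_of_ppm_data N) (auto simp: cert)
  qed
qed

end
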